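(* For all integers $n,k$ with $1\le k\le n$, we have, as $p\rightarrow\infty$ (with $p$ ranging over positive integers and $n,k$ fixed), the asymptotics $$A(p,n,k)\sim F(n,k)\times E(n,k)^p,$$ that is, $$\lim_{p\rightarrow\infty}\frac{A(p,n,k)}{F(n,k)\,E(n,k)^p}=1.$$
   Context: For integers $p\ge 1$ and $1\le k\le n$, $A(p,n,k)$ denotes the number of ordered $p$-tuples $(\sigma_1,\ldots,\sigma_p)$ of permutations in the symmetric group $\mathfrak{S}_n$ (permutations of $[n]:=\{1,\ldots,n\}$) which commute pairwise and are such that the subgroup $\langle\sigma_1,\ldots,\sigma_p\rangle$ of $\mathfrak{S}_n$ they generate has exactly $k$ orbits in its natural action on $[n]$. For $1\le k\le n$, $E(n,k):=\max a_1\cdots a_k$, where the maximum is over tuples of integers $a_1,\ldots,a_k\ge 1$ such that $a_1+\cdots+a_k=n$. For an integer $n\ge 1$ with prime factorization $n=q_1^{m_1}\cdots q_\ell^{m_\ell}$ (distinct primes $q_i$, exponents $m_i\ge 1$), $$H(n):=\prod_{i=1}^{\ell}\left[\frac{q_i^{\binom{m_i}{2}-m_i}}{(q_i-1)(q_i^2-1)\cdots(q_i^{m_i}-1)}\right],$$ with $H(1)=1$ (empty product). For $1\le k\le n$, $$F(n,k):=\frac{n!}{r!\,(k-r)!}\times H(b)^{k-r}\times H(b+1)^r,$$ where $n=bk+r$ is the Euclidean division of $n$ by $k$, i.e. $b=\lfloor n/k\rfloor$ and $0\le r<k$. *)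

theory Defs
  imports
    "HOL-Algebra.Sym_Groups"
    "HOL-Algebra.Group_Action"
    "HOL-Library.Landau_Symbols"
    "HOL-Computational_Algebra.Primes"
begin

text \<open>The generated subgroup of \<open>sym_group n\<close> acts on \<open>{1..n}\<close> by evaluation. The restriction to
  \<open>{1..n}\<close> does not affect the orbits; it makes this a \<open>group_action\<close> in the sense of the library,
  whose bijection group consists of extensional functions.\<close>

definition gen_orbits :: "nat \<Rightarrow> (nat \<Rightarrow> nat) list \<Rightarrow> nat set set" where
  "gen_orbits n \<sigma>s =
     orbits ((sym_group n)\<lparr>carrier := generate (sym_group n) (set \<sigma>s)\<rparr>) {1..n}
       (\<lambda>\<sigma>. restrict \<sigma> {1..n})"

definition comm_tuples :: "nat \<Rightarrow> nat \<Rightarrow> nat \<Rightarrow> (nat \<Rightarrow> nat) list set" where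
  "comm_tuples p n k =
     {\<sigma>s. length \<sigma>s = p \<and> set \<sigma>s \<subseteq> carrier (sym_group n) \<and>
          (\<forall>i<p. \<forall>j<p. \<sigma>s ! i \<otimes>\<^bsub>sym_group n\<^esub> \<sigma>s ! j = \<sigma>s ! j \<otimes>\<^bsub>sym_group n\<^esub> \<sigma>s ! i) \<and>
          card (gen_orbits n \<sigma>s) = k}"

definition A_num :: "nat \<Rightarrow> nat \<Rightarrow> nat \<Rightarrow> nat" where
  "A_num p n k = card (comm_tuples p n k)"

definition E_num :: "nat \<Rightarrow> nat \<Rightarrow> nat" where
  "E_num n k =
     Max {prod_list as | as :: nat list. length as = k \<and> (\<forall>a\<in>set as. a \<ge> 1) \<and> sum_list as = n}"

text \<open>The exponent \<open>m choose 2 - m\<close> is negative for \<open>m = 1\<close> and \<open>m = 2\<close>, hence an integer power.\<close>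

definition H_num :: "nat \<Rightarrow> real" where
  "H_num n =
     (\<Prod>q\<in>prime_factors n. let m = multiplicity q n in
        real q powi (int (m choose 2) - int m) / (\<Prod>i=1..m. real q ^ i - 1))"

definition F_num :: "nat \<Rightarrow> nat \<Rightarrow> real" where
  "F_num n k =
     (let b = n div k; r = n mod k
      in fact n / (fact r * fact (k - r)) * H_num b ^ (k - r) * H_num (b + 1) ^ r)"

end

theory Submission
  imports
    Defs
    "HOL-Combinatorics.Orbits"
    "HOL-Combinatorics.Multiset_Permutations"
    "HOL-Computational_Algebra.Computational_Algebra"
begin

text \<open>
  A commuting \<open>p\<close>-tuple of permutations of a finite set \<open>X\<close> is an action of \<open>\<int>\<^sup>p\<close> on \<open>X\<close>, so it is put
  together from the transitive actions on its orbits. Splitting off the orbit of one point gives a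
  recursion (\<open>card_commuting_with_orbits_Suc\<close>) which is the exponential formula: the number of tuples
  with \<open>k\<close> orbits on \<open>n\<close> points is \<open>n!/k!\<close> times the coefficient of \<open>x\<^sup>n\<close> in \<open>t\<^sup>k\<close>, where \<open>t\<close> is the
  exponential generating function of the transitive tuples (\<open>card_commuting_with_orbits\<close>).

  A transitive action of \<open>\<int>\<^sup>p\<close> with a base point is a subgroup of \<open>\<int>\<^sup>p\<close>, the stabiliser, so there are
  \<open>(n - 1)! s\<^sub>p(n)\<close> transitive tuples on \<open>n\<close> points, where \<open>s\<^sub>p(n)\<close> counts the subgroups of index \<open>n\<close>.
  These satisfy \<open>s\<^sub>p\<^sub>+\<^sub>1(n) = \<Sum>d|n. d s\<^sub>p(d)\<close>. The proof finds this recursion on the permutations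
  themselves (\<open>card_transitive_Suc\<close>) and never mentions subgroups: let \<open>B\<close> be the orbit of the base
  point under all permutations but the first one, \<open>\<sigma>\<close>. The sets \<open>B\<close>, \<open>\<sigma> B\<close>, \<open>\<sigma>\<^sup>2 B\<close>, ... tile \<open>X\<close> until
  they return to \<open>B\<close>, so the tuple is determined by its restriction to \<open>B\<close>, the way in which copies
  of \<open>B\<close> are laid out in \<open>X\<close>, and the return map of \<open>\<sigma>\<close> to \<open>B\<close>. The return map centralises a transitive
  commuting tuple on \<open>B\<close>, and such a centraliser acts simply transitively: there are \<open>|B|\<close> choices.

  The recursion has the multiplicative solution whose value at a prime power \<open>q\<^sup>m\<close> is the Gaussian
  binomial coefficient of \<open>p + m - 1\<close> over \<open>m\<close> (\<open>sublattices_closed_form\<close>), a product of \<open>m\<close> factors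
  each of order \<open>q\<^sup>p\<close>. Hence \<open>s\<^sub>p(a) / a\<close> is asymptotically \<open>H(a) a\<^sup>p\<close> (\<open>sublattices_asymp\<close>).

  The coefficient of \<open>x\<^sup>n\<close> in \<open>t\<^sup>k\<close> is a sum over the compositions of \<open>n\<close> into \<open>k\<close> parts, and by the above
  the term of \<open>a\<^sub>1, ..., a\<^sub>k\<close> grows like \<open>H(a\<^sub>1) ... H(a\<^sub>k) (a\<^sub>1 ... a\<^sub>k)\<^sup>p\<close>. Only the compositions
  of maximal product survive the division by \<open>E(n,k)\<^sup>p\<close>. Those are the arrangements of \<open>k - r\<close> parts
  \<open>b\<close> and \<open>r\<close> parts \<open>b + 1\<close> (\<open>prod_list_le_balanced\<close>), and they contribute equally.
\<close>

section \<open>Orbits of commuting permutations\<close>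

text \<open>
  Only forward steps are taken. On a finite set this already gives the orbits of the generated
  group, because the inverse of a permutation is one of its powers.
\<close>

inductive_set reach :: "('a \<Rightarrow> 'a) set \<Rightarrow> 'a \<Rightarrow> 'a set"
  for F :: "('a \<Rightarrow> 'a) set" and x :: 'a where
  refl: "x \<in> reach F x"
| step: "y \<in> reach F x \<Longrightarrow> f \<in> F \<Longrightarrow> f y \<in> reach F x"

lemma reach_least:
  assumes "x \<in> S" and "\<And>f y. f \<in> F \<Longrightarrow> y \<in> S \<Longrightarrow> f y \<in> S"
  shows "reach F x \<subseteq> S"
proof
  fix y assume "y \<in> reach F x"
  then show "y \<in> S" by induction (use assms in auto)
qed

lemma reach_mono_start: "y \<in> reach F x \<Longrightarrow> reach F y \<subseteq> reach F x"
  by (rule reach_least) (auto intro: reach.intros)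

lemma reach_subset:
  assumes "\<And>f. f \<in> F \<Longrightarrow> f permutes X" and "x \<in> X"
  shows "reach F x \<subseteq> X"
  by (rule reach_least) (use assms in \<open>auto simp: permutes_in_image\<close>)

lemma reach_cong:
  assumes "x \<in> S" and eq: "\<And>i y. i \<in> I \<Longrightarrow> y \<in> S \<Longrightarrow> f i y = g i y"
    and closed: "\<And>i y. i \<in> I \<Longrightarrow> y \<in> S \<Longrightarrow> f i y \<in> S"
  shows "reach (f ` I) x = reach (g ` I) x"
proof -
  have "y \<in> reach (g ` I) x \<and> y \<in> S" if "y \<in> reach (f ` I) x" for y
    using that
  proof induction
    case (step y h)
    then obtain i where "i \<in> I" "h = f i" by auto
    with step show ?case using eq closed by (metis image_eqI reach.step)
  qed (use assms in \<open>auto intro: reach.intros\<close>)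
  moreover have "y \<in> reach (f ` I) x \<and> y \<in> S" if "y \<in> reach (g ` I) x" for y
    using that
  proof induction
    case (step y h)
    then obtain i where "i \<in> I" "h = g i" by auto
    with step show ?case using eq closed by (metis image_eqI reach.step)
  qed (use assms in \<open>auto intro: reach.intros\<close>)
  ultimately show ?thesis by blast
qed

text \<open>
  A finite set that an injective map sends into itself is sent onto itself; this is what makes
  forward reachability closed under inverses.
\<close>

lemma reach_image:
  assumes "finite X" and F: "\<And>f. f \<in> F \<Longrightarrow> f permutes X" and "x \<in> X" and f: "f \<in> F"
  shows "f ` reach F x = reach F x"
proof (rule endo_inj_surj)
  show "finite (reach F x)" using reach_subset[OF F] assms finite_subset by metis
  show "inj_on f (reach F x)" using permutes_inj_on[OF F[OF f]] by simp
qed (use f in \<open>auto intro: reach.step\<close>)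

lemma reach_sym:
  assumes "finite X" and F: "\<And>f. f \<in> F \<Longrightarrow> f permutes X" and "x \<in> X" and "y \<in> reach F x"
  shows "x \<in> reach F y"
  using assms(4)
proof induction
  case (step y f)
  have "y \<in> X" using step reach_subset[OF F \<open>x \<in> X\<close>] by blast
  then have fy: "f y \<in> X" using F[OF \<open>f \<in> F\<close>] by (simp add: permutes_in_image)
  have "f y \<in> f ` reach F (f y)"
    using reach_image[OF \<open>finite X\<close> F fy \<open>f \<in> F\<close>] reach.refl[of "f y" F] by simp
  then have "y \<in> reach F (f y)"
    using permutes_inj[OF F[OF \<open>f \<in> F\<close>]] by (auto dest: injD)
  from reach_mono_start[OF this] show ?case using step.IH by (rule subsetD)
qed (rule reach.refl)

lemma reach_eq:
  assumes "finite X" and F: "\<And>f. f \<in> F \<Longrightarrow> f permutes X" and "x \<in> X" and "y \<in> reach F x"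
  shows "reach F y = reach F x"
proof (rule subset_antisym)
  show "reach F y \<subseteq> reach F x" using assms(4) by (rule reach_mono_start)
  show "reach F x \<subseteq> reach F y" using reach_sym[OF assms] by (rule reach_mono_start)
qed

lemma reach_commute:
  assumes "\<And>f. f \<in> F \<Longrightarrow> f \<circ> g = g \<circ> f"
  shows "reach F (g x) = g ` reach F x"
proof -
  have c: "f (g y) = g (f y)" if "f \<in> F" for f y using assms[OF that] by (metis comp_apply)
  have "reach F (g x) \<subseteq> g ` reach F x"
    by (rule reach_least) (auto simp: c intro: reach.intros)
  moreover have "g y \<in> reach F (g x)" if "y \<in> reach F x" for y
    using that by induction (auto simp: c[symmetric] intro: reach.intros)
  ultimately show ?thesis by blast
qed

text \<open>
  In an abelian group acting on \<open>X\<close>, the group elements themselves are automorphisms of the action,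
  and they act transitively on each orbit.
\<close>

lemma reach_realised_by_commuting:
  assumes F: "\<And>f. f \<in> F \<Longrightarrow> f permutes X"
    and comm: "\<And>f g. f \<in> F \<Longrightarrow> g \<in> F \<Longrightarrow> f \<circ> g = g \<circ> f" and "y \<in> reach F x"
  shows "\<exists>g. g permutes X \<and> (\<forall>f\<in>F. f \<circ> g = g \<circ> f) \<and> g x = y"
  using assms(3)
proof induction
  case refl
  show ?case by (intro exI[of _ id] conjI ballI permutes_id) simp_all
next
  case (step y f)
  then obtain g where g: "g permutes X" "\<forall>h\<in>F. h \<circ> g = g \<circ> h" "g x = y" by blast
  have "h \<circ> (f \<circ> g) = (f \<circ> g) \<circ> h" if "h \<in> F" for h
    using comm[OF that \<open>f \<in> F\<close>] g(2) that by (metis comp_assoc)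
  then show ?case
    using permutes_compose[OF g(1) F[OF \<open>f \<in> F\<close>]] g(3) by (metis comp_apply)
qed

definition commuting_tuples :: "nat \<Rightarrow> 'a set \<Rightarrow> ('a \<Rightarrow> 'a) list set" where
  "commuting_tuples p X = {\<sigma>s. length \<sigma>s = p \<and> (\<forall>\<sigma>\<in>set \<sigma>s. \<sigma> permutes X) \<and>
     (\<forall>\<sigma>\<in>set \<sigma>s. \<forall>\<tau>\<in>set \<sigma>s. \<sigma> \<circ> \<tau> = \<tau> \<circ> \<sigma>)}"

definition commuting_with_orbits :: "nat \<Rightarrow> 'a set \<Rightarrow> nat \<Rightarrow> ('a \<Rightarrow> 'a) list set" where
  "commuting_with_orbits p X k = {\<sigma>s \<in> commuting_tuples p X. card (reach (set \<sigma>s) ` X) = k}"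

definition transitive_tuples :: "nat \<Rightarrow> 'a set \<Rightarrow> ('a \<Rightarrow> 'a) list set" where
  "transitive_tuples p X = {\<sigma>s \<in> commuting_tuples p X. \<forall>x\<in>X. reach (set \<sigma>s) x = X}"

lemma finite_commuting: "finite X \<Longrightarrow> finite (commuting_tuples p X)"
  by (rule finite_subset[OF _ finite_lists_length_eq[of "{\<sigma>. \<sigma> permutes X}" p]])
     (auto simp: commuting_tuples_def finite_permutations)

lemma finite_commuting_with_orbits: "finite X \<Longrightarrow> finite (commuting_with_orbits p X k)"
  and finite_transitive_tuples: "finite X \<Longrightarrow> finite (transitive_tuples p X)"
  by (simp_all add: commuting_with_orbits_def transitive_tuples_def finite_commuting)

lemma transitive_tuplesI:
  assumes "finite X" "x \<in> X" "\<sigma>s \<in> commuting_tuples p X" "X \<subseteq> reach (set \<sigma>s) x"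
  shows "\<sigma>s \<in> transitive_tuples p X"
proof -
  have F: "f permutes X" if "f \<in> set \<sigma>s" for f using assms that by (simp add: commuting_tuples_def)
  have x: "reach (set \<sigma>s) x = X" 
    using reach_subset[of "set \<sigma>s" X, OF F \<open>x \<in> X\<close>] assms(4) by (rule subset_antisym)
  have "reach (set \<sigma>s) y = X" if "y \<in> X" for y
    using reach_eq[of X "set \<sigma>s" x y, OF \<open>finite X\<close> F \<open>x \<in> X\<close>] that x by simp
  then show ?thesis using assms(3) by (simp add: transitive_tuples_def)
qed

text \<open>
  By \<open>reach_image\<close> every generator, hence every element of the generated group, maps each \<open>reach\<close> set
  onto itself.
\<close>

lemma gen_orbits_eq:
  assumes "set \<sigma>s \<subseteq> carrier (sym_group n)"
  shows "gen_orbits n \<sigma>s = reach (set \<sigma>s) ` {1..n}"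
proof -
  let ?S = "sym_group n" and ?X = "{1..n}"
  interpret group ?S by (rule sym_group_is_group)
  have F: "f permutes ?X" if "f \<in> set \<sigma>s" for f
    using assms that by (auto simp: sym_group_carrier)
  have "{g x |g. g \<in> generate ?S (set \<sigma>s)} = reach (set \<sigma>s) x" if x: "x \<in> ?X" for x
  proof -
    have "g ` reach (set \<sigma>s) x = reach (set \<sigma>s) x" if "g \<in> generate ?S (set \<sigma>s)" for g
      using that
    proof (induction g)
      case one
      then show ?case by (simp add: sym_group_one)
    next
      case (incl f)
      then show ?case using reach_image[OF _ F x] by simp
    next
      case (inv f)
      then have "inv\<^bsub>?S\<^esub> f \<otimes>\<^bsub>?S\<^esub> f = \<one>\<^bsub>?S\<^esub>" using assms by (intro l_inv) auto
      then have "(inv\<^bsub>?S\<^esub> f) \<circ> f = id" by (simp add: sym_group_mult sym_group_one)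
      then have "(inv\<^bsub>?S\<^esub> f) ` f ` reach (set \<sigma>s) x = reach (set \<sigma>s) x"
        by (simp add: image_comp)
      then show ?case using reach_image[OF _ F x inv] by simp
    next
      case (eng g h)
      then have "g ` h ` reach (set \<sigma>s) x = reach (set \<sigma>s) x" by simp
      then show ?case by (simp only: sym_group_mult image_comp)
    qed
    then have "{g x |g. g \<in> generate ?S (set \<sigma>s)} \<subseteq> reach (set \<sigma>s) x"
      using reach.refl[of x "set \<sigma>s"] by blast
    moreover have "\<exists>g \<in> generate ?S (set \<sigma>s). y = g x" if "y \<in> reach (set \<sigma>s) x" for y
      using that
    proof induction
      case refl
      show ?case using generate.one[of ?S "set \<sigma>s"] by (intro bexI) (auto simp: sym_group_one)
    next
      case (step y f)
      then obtain g where g: "g \<in> generate ?S (set \<sigma>s)" "y = g x" by blast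
      with generate.eng[OF generate.incl[OF \<open>f \<in> set \<sigma>s\<close>] g(1)] show ?case
        by (intro bexI[of _ "f \<otimes>\<^bsub>?S\<^esub> g"]) (simp_all add: sym_group_mult)
    qed
    ultimately show ?thesis by blast
  qed
  moreover have "Group_Action.orbit (?S\<lparr>carrier := generate ?S (set \<sigma>s)\<rparr>) (\<lambda>\<sigma>. restrict \<sigma> ?X) x
     = {g x |g. g \<in> generate ?S (set \<sigma>s)}" if "x \<in> ?X" for x
    using that by (auto simp: Group_Action.orbit_def)
  ultimately have "Group_Action.orbit (?S\<lparr>carrier := generate ?S (set \<sigma>s)\<rparr>) (\<lambda>\<sigma>. restrict \<sigma> ?X) x
     = reach (set \<sigma>s) x" if "x \<in> ?X" for x using that by simp
  then show ?thesis unfolding gen_orbits_def orbits_def Setcompr_eq_image Collect_mem_eq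
    by (rule image_cong[OF HOL.refl])
qed

lemma A_num_eq: "A_num p n k = card (commuting_with_orbits p {1..n} k)"
proof -
  have "\<sigma>s \<in> comm_tuples p n k \<longleftrightarrow> \<sigma>s \<in> commuting_with_orbits p {1..n} k" for \<sigma>s
  proof (cases "set \<sigma>s \<subseteq> carrier (sym_group n)")
    case True
    then have "\<forall>\<sigma>\<in>set \<sigma>s. \<sigma> permutes {1..n}" by (auto simp: sym_group_carrier)
    moreover have "(\<forall>\<sigma>\<in>set \<sigma>s. \<forall>\<tau>\<in>set \<sigma>s. \<sigma> \<circ> \<tau> = \<tau> \<circ> \<sigma>) \<longleftrightarrow>
        (\<forall>i<length \<sigma>s. \<forall>j<length \<sigma>s. \<sigma>s ! i \<circ> \<sigma>s ! j = \<sigma>s ! j \<circ> \<sigma>s ! i)"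
      by (simp only: all_set_conv_all_nth)
    ultimately show ?thesis using True
      unfolding comm_tuples_def commuting_with_orbits_def commuting_tuples_def mem_Collect_eq
        gen_orbits_eq[OF True] sym_group_mult
      by blast
  next
    case False
    then show ?thesis
      by (auto simp: comm_tuples_def commuting_with_orbits_def commuting_tuples_def sym_group_carrier)
  qed
  then have "comm_tuples p n k = commuting_with_orbits p {1..n} k" by blast
  then show ?thesis by (simp add: A_num_def)
qed

section \<open>Splitting off one orbit\<close>

definition glue :: "'a set \<Rightarrow> ('a \<Rightarrow> 'a) \<Rightarrow> ('a \<Rightarrow> 'a) \<Rightarrow> 'a \<Rightarrow> 'a" where
  "glue B \<alpha> \<beta> x = (if x \<in> B then \<alpha> x else \<beta> x)"

lemma reach_set_cong:
  assumes "length \<sigma>s = length \<tau>s" "x \<in> S"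
    and "\<And>i y. i < length \<tau>s \<Longrightarrow> y \<in> S \<Longrightarrow> (\<sigma>s ! i) y = (\<tau>s ! i) y"
    and "\<And>i y. i < length \<tau>s \<Longrightarrow> y \<in> S \<Longrightarrow> (\<sigma>s ! i) y \<in> S"
  shows "reach (set \<sigma>s) x = reach (set \<tau>s) x"
proof -
  have "set xs = (!) xs ` {..<length \<tau>s}" if "length xs = length \<tau>s" for xs :: "('a \<Rightarrow> 'a) list"
    using that by (auto simp: set_conv_nth)
  then show ?thesis
    using reach_cong[of x S "{..<length \<tau>s}" "(!) \<sigma>s" "(!) \<tau>s"] assms by simp
qed

text \<open>
  Positions rather than elements: this is the form in which tuples on disjoint sets can be zipped.
\<close>

lemma commuting_nth:
  "\<sigma>s \<in> commuting_tuples p X \<longleftrightarrow> length \<sigma>s = p \<and> (\<forall>i<p. \<sigma>s ! i permutes X) \<and>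
     (\<forall>i<p. \<forall>j<p. \<forall>x\<in>X. (\<sigma>s ! i) ((\<sigma>s ! j) x) = (\<sigma>s ! j) ((\<sigma>s ! i) x))"
proof -
  have "\<sigma> \<circ> \<tau> = \<tau> \<circ> \<sigma> \<longleftrightarrow> (\<forall>x\<in>X. \<sigma> (\<tau> x) = \<tau> (\<sigma> x))"
    if "\<sigma> permutes X" "\<tau> permutes X" for \<sigma> \<tau> :: "'a \<Rightarrow> 'a"
    using that by (auto simp: fun_eq_iff) (metis permutes_not_in)
  then have "(\<forall>i<length \<sigma>s. \<forall>j<length \<sigma>s. \<sigma>s ! i \<circ> \<sigma>s ! j = \<sigma>s ! j \<circ> \<sigma>s ! i) \<longleftrightarrow>
      (\<forall>i<length \<sigma>s. \<forall>j<length \<sigma>s. \<forall>x\<in>X. (\<sigma>s ! i) ((\<sigma>s ! j) x) = (\<sigma>s ! j) ((\<sigma>s ! i) x))"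
    if "\<forall>i<length \<sigma>s. \<sigma>s ! i permutes X"
    using that by simp
  then show ?thesis
    unfolding commuting_tuples_def mem_Collect_eq all_set_conv_all_nth by metis
qed

lemma perm_restrict_permutes:
  assumes "\<sigma> permutes X" "B \<subseteq> X" "finite X" "\<And>x. x \<in> B \<Longrightarrow> \<sigma> x \<in> B"
  shows "perm_restrict \<sigma> B permutes B"
proof (rule inj_imp_permutes)
  show "inj_on (perm_restrict \<sigma> B) B"
    using permutes_inj[OF assms(1)] by (auto simp: inj_on_def perm_restrict_simps dest: injD)
qed (use assms in \<open>auto simp: perm_restrict_simps intro: finite_subset\<close>)

lemma glue_permutes:
  assumes "\<alpha> permutes B" "\<beta> permutes C" "B \<inter> C = {}"
  shows "glue B \<alpha> \<beta> permutes (B \<union> C)"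
proof (rule bij_imp_permutes)
  have "bij_betw (glue B \<alpha> \<beta>) B B"
    using permutes_imp_bij[OF assms(1)] by (simp add: glue_def cong: bij_betw_cong)
  moreover have "bij_betw (glue B \<alpha> \<beta>) C C \<longleftrightarrow> bij_betw \<beta> C C"
    by (rule bij_betw_cong) (use assms(3) in \<open>auto simp: glue_def\<close>)
  ultimately show "bij_betw (glue B \<alpha> \<beta>) (B \<union> C) (B \<union> C)"
    using permutes_imp_bij[OF assms(2)] assms(3) by (intro bij_betw_combine) simp_all
qed (use assms in \<open>auto simp: glue_def permutes_not_in\<close>)

lemma restrict_commuting:
  assumes "\<sigma>s \<in> commuting_tuples p X" "B \<subseteq> X" "finite X"
    and "\<And>\<sigma> x. \<sigma> \<in> set \<sigma>s \<Longrightarrow> x \<in> B \<Longrightarrow> \<sigma> x \<in> B"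
  shows "map (\<lambda>\<sigma>. perm_restrict \<sigma> B) \<sigma>s \<in> commuting_tuples p B"
proof -
  have p: "length \<sigma>s = p" using assms(1) by (simp add: commuting_nth)
  have closed: "(\<sigma>s ! i) x \<in> B" if "i < p" "x \<in> B" for i x using assms(4) p that by simp
  show ?thesis
    unfolding commuting_nth
    using assms p closed by (auto simp: perm_restrict_simps commuting_nth intro!: perm_restrict_permutes)
qed

lemma reach_restrict:
  assumes "x \<in> B" and "\<And>\<sigma> x. \<sigma> \<in> set \<sigma>s \<Longrightarrow> x \<in> B \<Longrightarrow> \<sigma> x \<in> B"
  shows "reach (set (map (\<lambda>\<sigma>. perm_restrict \<sigma> B) \<sigma>s)) x = reach (set \<sigma>s) x"
  using assms by (intro reach_set_cong[where S = B]) (auto simp: perm_restrict_simps)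

lemma glue_commuting:
  assumes "\<alpha>s \<in> commuting_tuples p B" "\<beta>s \<in> commuting_tuples p C" "B \<inter> C = {}"
  shows "map2 (glue B) \<alpha>s \<beta>s \<in> commuting_tuples p (B \<union> C)"
proof -
  have len: "length \<alpha>s = p" "length \<beta>s = p"
    and perm: "\<And>i. i < p \<Longrightarrow> \<alpha>s ! i permutes B" "\<And>i. i < p \<Longrightarrow> \<beta>s ! i permutes C"
    and comm: "\<And>i j x. i < p \<Longrightarrow> j < p \<Longrightarrow> x \<in> B \<Longrightarrow> (\<alpha>s ! i) ((\<alpha>s ! j) x) = (\<alpha>s ! j) ((\<alpha>s ! i) x)"
      "\<And>i j x. i < p \<Longrightarrow> j < p \<Longrightarrow> x \<in> C \<Longrightarrow> (\<beta>s ! i) ((\<beta>s ! j) x) = (\<beta>s ! j) ((\<beta>s ! i) x)"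
    using assms by (simp_all add: commuting_nth)
  have in_B: "(\<alpha>s ! i) x \<in> B" if "i < p" "x \<in> B" for i x
    using perm(1) that by (simp add: permutes_in_image)
  have in_C: "(\<beta>s ! i) x \<in> C" if "i < p" "x \<in> C" for i x
    using perm(2) that by (simp add: permutes_in_image)
  have "glue B (\<alpha>s ! i) (\<beta>s ! i) (glue B (\<alpha>s ! j) (\<beta>s ! j) x)
      = glue B (\<alpha>s ! j) (\<beta>s ! j) (glue B (\<alpha>s ! i) (\<beta>s ! i) x)"
    if "i < p" "j < p" "x \<in> B \<union> C" for i j x
  proof (cases "x \<in> B")
    case True
    then show ?thesis using that in_B comm by (simp add: glue_def)
  next
    case False
    then have "x \<in> C" using that by simp
    moreover from this have "(\<beta>s ! i) x \<notin> B" "(\<beta>s ! j) x \<notin> B"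
      using in_C that \<open>B \<inter> C = {}\<close> by blast+
    ultimately show ?thesis using that False comm by (simp add: glue_def)
  qed
  then show ?thesis
    unfolding commuting_nth using len perm glue_permutes[OF _ _ assms(3)] by simp
qed

lemma reach_glue:
  assumes "\<alpha>s \<in> commuting_tuples p B" "\<beta>s \<in> commuting_tuples p C" "B \<inter> C = {}"
  shows "x \<in> B \<Longrightarrow> reach (set (map2 (glue B) \<alpha>s \<beta>s)) x = reach (set \<alpha>s) x"
    and "x \<in> C \<Longrightarrow> reach (set (map2 (glue B) \<alpha>s \<beta>s)) x = reach (set \<beta>s) x"
proof -
  have len: "length \<alpha>s = p" "length \<beta>s = p"
    and perm: "\<And>i. i < p \<Longrightarrow> \<alpha>s ! i permutes B" "\<And>i. i < p \<Longrightarrow> \<beta>s ! i permutes C"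
    using assms by (simp_all add: commuting_nth)
  show "reach (set (map2 (glue B) \<alpha>s \<beta>s)) x = reach (set \<alpha>s) x" if "x \<in> B"
    by (rule reach_set_cong[where S = B])
      (use that len perm in \<open>auto simp: glue_def permutes_in_image\<close>)
  have "y \<notin> B" if "y \<in> C" for y using that assms(3) by blast
  then show "reach (set (map2 (glue B) \<alpha>s \<beta>s)) x = reach (set \<beta>s) x" if "x \<in> C"
    by (intro reach_set_cong[where S = C])
      (use that len perm in \<open>auto simp: glue_def permutes_in_image\<close>)
qed

text \<open>
  Once the orbit \<open>B\<close> of \<open>x0\<close> is fixed, a tuple is the same as its pair of restrictions: to \<open>B\<close>, where it
  is transitive, and to \<open>X - B\<close>, where it is an arbitrary tuple with one orbit fewer. Conversely, any
  such pair can be glued.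
\<close>

lemma card_first_orbit:
  assumes fin: "finite X" and x0: "x0 \<in> B" and B: "B \<subseteq> X"
  shows "card {\<sigma>s \<in> commuting_with_orbits p X (Suc k). reach (set \<sigma>s) x0 = B} =
    card (transitive_tuples p B) * card (commuting_with_orbits p (X - B) k)"
proof -
  let ?P = "{\<sigma>s \<in> commuting_with_orbits p X (Suc k). reach (set \<sigma>s) x0 = B}"
  let ?Q = "transitive_tuples p B \<times> commuting_with_orbits p (X - B) k"
  let ?join = "\<lambda>(\<alpha>s, \<beta>s). map2 (glue B) \<alpha>s \<beta>s"
  let ?res = "\<lambda>C \<sigma>s. map (\<lambda>\<sigma>. perm_restrict \<sigma> C) \<sigma>s"
  let ?split = "\<lambda>\<sigma>s. (?res B \<sigma>s, ?res (X - B) \<sigma>s)"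
  have finB: "finite B" using fin B finite_subset by blast
  have orbits: "card (reach (set \<sigma>s) ` X) = Suc (card (reach (set \<sigma>s) ` (X - B)))"
    if \<sigma>s: "\<sigma>s \<in> commuting_tuples p X" and eq: "\<And>x. x \<in> B \<Longrightarrow> reach (set \<sigma>s) x = B"
      and out: "\<And>x. x \<in> X - B \<Longrightarrow> reach (set \<sigma>s) x \<subseteq> X - B" for \<sigma>s
  proof -
    have "reach (set \<sigma>s) ` B = {B}" using eq x0 by auto
    moreover have "X = B \<union> (X - B)" using B by blast
    ultimately have "reach (set \<sigma>s) ` X = insert B (reach (set \<sigma>s) ` (X - B))"
      by (metis image_Un insert_is_Un)
    moreover have "B \<notin> reach (set \<sigma>s) ` (X - B)" using out x0 by blast
    ultimately show ?thesis using fin by simp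
  qed
  have "bij_betw ?join ?Q ?P"
  proof (rule bij_betw_byWitness[where f' = ?split])
    show "\<forall>a\<in>?Q. ?split (?join a) = a"
    proof (clarify, intro conjI)
      fix \<alpha>s \<beta>s assume a: "\<alpha>s \<in> transitive_tuples p B" "\<beta>s \<in> commuting_with_orbits p (X - B) k"
      then have len: "length \<alpha>s = p" "length \<beta>s = p"
        and perm: "\<And>i. i < p \<Longrightarrow> \<alpha>s ! i permutes B" "\<And>i. i < p \<Longrightarrow> \<beta>s ! i permutes X - B"
        by (simp_all add: commuting_nth transitive_tuples_def commuting_with_orbits_def)
      have 1: "perm_restrict (glue B (\<alpha>s ! i) (\<beta>s ! i)) B = \<alpha>s ! i" if "i < p" for i
        using perm(1)[OF that] by (auto simp: fun_eq_iff perm_restrict_def glue_def permutes_not_in)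
      have 2: "perm_restrict (glue B (\<alpha>s ! i) (\<beta>s ! i)) (X - B) = \<beta>s ! i" if "i < p" for i
        using permutes_not_in[OF perm(2)[OF that]] by (auto simp: fun_eq_iff perm_restrict_def glue_def)
      show "?res B (map2 (glue B) \<alpha>s \<beta>s) = \<alpha>s" "?res (X - B) (map2 (glue B) \<alpha>s \<beta>s) = \<beta>s"
        by (auto intro!: nth_equalityI simp: len 1 2)
    qed
    show "\<forall>\<sigma>s\<in>?P. ?join (?split \<sigma>s) = \<sigma>s"
    proof
      fix \<sigma>s assume "\<sigma>s \<in> ?P"
      then have \<sigma>s: "\<sigma>s \<in> commuting_tuples p X" by (simp add: commuting_with_orbits_def)
      have "glue B (perm_restrict \<sigma> B) (perm_restrict \<sigma> (X - B)) = \<sigma>" if "\<sigma> permutes X" for \<sigma>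
        using permutes_not_in[OF that] B by (auto simp: fun_eq_iff perm_restrict_def glue_def)
      then show "?join (?split \<sigma>s) = \<sigma>s"
        using \<sigma>s by (auto intro!: nth_equalityI simp: commuting_nth)
    qed
    show "?join ` ?Q \<subseteq> ?P"
    proof clarify
      fix \<alpha>s \<beta>s assume a: "\<alpha>s \<in> transitive_tuples p B" "\<beta>s \<in> commuting_with_orbits p (X - B) k"
      then have c: "\<alpha>s \<in> commuting_tuples p B" "\<beta>s \<in> commuting_tuples p (X - B)"
        and t: "\<And>x. x \<in> B \<Longrightarrow> reach (set \<alpha>s) x = B"
        and k: "card (reach (set \<beta>s) ` (X - B)) = k"
        by (auto simp: transitive_tuples_def commuting_with_orbits_def)
      let ?\<sigma>s = "map2 (glue B) \<alpha>s \<beta>s"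
      have BX: "B \<union> (X - B) = X" using B by blast
      have \<sigma>s: "?\<sigma>s \<in> commuting_tuples p X" using glue_commuting[OF c] unfolding BX by blast
      note r = reach_glue[OF c]
      have "reach (set ?\<sigma>s) ` (X - B) = reach (set \<beta>s) ` (X - B)"
        by (rule image_cong) (use r(2) in auto)
      moreover have "card (reach (set ?\<sigma>s) ` X) = Suc (card (reach (set ?\<sigma>s) ` (X - B)))"
      proof (rule orbits[OF \<sigma>s])
        show "reach (set ?\<sigma>s) x = B" if "x \<in> B" for x using r(1) t that by simp
        show "reach (set ?\<sigma>s) x \<subseteq> X - B" if "x \<in> X - B" for x
          using r(2) reach_subset[of "set \<beta>s" "X - B" x] c(2) that by (simp add: commuting_tuples_def)
      qed
      ultimately show "?\<sigma>s \<in> commuting_with_orbits p X (Suc k) \<and> reach (set ?\<sigma>s) x0 = B"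
        using \<sigma>s k r(1) t x0 by (simp add: commuting_with_orbits_def)
    qed
    show "?split ` ?P \<subseteq> ?Q"
    proof (rule image_subsetI)
      fix \<sigma>s assume P: "\<sigma>s \<in> ?P"
      then have r0: "B = reach (set \<sigma>s) x0" by simp
      from P have \<sigma>s: "\<sigma>s \<in> commuting_tuples p X" and k: "card (reach (set \<sigma>s) ` X) = Suc k"
        by (auto simp: commuting_with_orbits_def)
      have perm: "f permutes X" if "f \<in> set \<sigma>s" for f using \<sigma>s that by (simp add: commuting_tuples_def)
      have inB: "\<sigma> x \<in> B" if "\<sigma> \<in> set \<sigma>s" "x \<in> B" for \<sigma> x
        using that unfolding r0 by (auto intro: reach.step)
      have out: "\<sigma> x \<in> X - B" if "\<sigma> \<in> set \<sigma>s" "x \<in> X - B" for \<sigma> x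
      proof -
        have "\<sigma> ` B = B" unfolding r0
          using reach_image[OF fin perm _ that(1)] x0 B by blast
        then have "\<sigma> x \<notin> B" using that permutes_inj[OF perm[OF that(1)]]
          by (metis DiffD2 inj_image_mem_iff)
        then show ?thesis using that perm by (simp add: permutes_in_image)
      qed
      have t: "reach (set \<sigma>s) x = B" if "x \<in> B" for x
        using reach_eq[of X "set \<sigma>s" x0 x, OF fin perm] that x0 B unfolding r0 by blast
      have outr: "reach (set \<sigma>s) x \<subseteq> X - B" if "x \<in> X - B" for x
        by (rule reach_least) (use that out in auto)
      have res: "?res C \<sigma>s \<in> commuting_tuples p C" if "C = B \<or> C = X - B" for C
        by (rule restrict_commuting[OF \<sigma>s _ fin]) (use that B inB out in auto)
      have "reach (set (?res (X - B) \<sigma>s)) ` (X - B) = reach (set \<sigma>s) ` (X - B)"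
        by (rule image_cong) (use reach_restrict[of _ "X - B" \<sigma>s] out in auto)
      then have "?res (X - B) \<sigma>s \<in> commuting_with_orbits p (X - B) k"
        using res orbits[OF \<sigma>s t outr] k
        by (simp add: commuting_with_orbits_def)
      moreover have "?res B \<sigma>s \<in> transitive_tuples p B"
        using res reach_restrict[of _ B \<sigma>s] inB t
        by (simp add: transitive_tuples_def)
      ultimately show "?split \<sigma>s \<in> ?Q" by simp
    qed
  qed
  then show ?thesis by (simp add: bij_betw_same_card[symmetric] card_cartesian_product)
qed

lemma card_commuting_with_orbits_Suc:
  assumes fin: "finite X" and x0: "x0 \<in> X"
  shows "card (commuting_with_orbits p X (Suc k)) =
    (\<Sum>B | x0 \<in> B \<and> B \<subseteq> X. card (transitive_tuples p B) * card (commuting_with_orbits p (X - B) k))"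
proof -
  let ?I = "{B. x0 \<in> B \<and> B \<subseteq> X}"
  have sub: "reach (set \<sigma>s) x0 \<in> ?I" if "\<sigma>s \<in> commuting_with_orbits p X (Suc k)" for \<sigma>s
    using that reach_subset[of "set \<sigma>s" X x0] x0 reach.refl[of x0]
    by (auto simp: commuting_with_orbits_def commuting_tuples_def)
  have "card (commuting_with_orbits p X (Suc k)) =
      (\<Sum>B\<in>?I. card {\<sigma>s \<in> commuting_with_orbits p X (Suc k). reach (set \<sigma>s) x0 = B})"
    using sub fin
    by (subst card_UN_disjoint[symmetric])
      (auto simp: finite_commuting_with_orbits intro!: arg_cong[where f = card] finite_subset[of ?I "Pow X"])
  also have "\<dots> = (\<Sum>B\<in>?I. card (transitive_tuples p B) * card (commuting_with_orbits p (X - B) k))"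
    by (rule sum.cong) (use card_first_orbit[OF fin] in auto)
  finally show ?thesis .
qed

section \<open>Transitive tuples and the return map\<close>

lemma commuting_Cons:
  "\<sigma> # \<tau>s \<in> commuting_tuples (Suc p) X \<longleftrightarrow>
     \<tau>s \<in> commuting_tuples p X \<and> \<sigma> permutes X \<and> (\<forall>\<tau>\<in>set \<tau>s. \<tau> \<circ> \<sigma> = \<sigma> \<circ> \<tau>)"
proof -
  have "(\<forall>\<tau>\<in>set \<tau>s. \<sigma> \<circ> \<tau> = \<tau> \<circ> \<sigma>) \<longleftrightarrow> (\<forall>\<tau>\<in>set \<tau>s. \<tau> \<circ> \<sigma> = \<sigma> \<circ> \<tau>)"
    by (intro ball_cong) (simp_all only: eq_commute)
  then show ?thesis unfolding commuting_tuples_def by (simp add: ball_conj_distrib del: comp_apply) blast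
qed

definition centraliser :: "'a set \<Rightarrow> ('a \<Rightarrow> 'a) list \<Rightarrow> ('a \<Rightarrow> 'a) set" where
  "centraliser X \<tau>s = {c. c permutes X \<and> (\<forall>\<tau>\<in>set \<tau>s. \<tau> \<circ> c = c \<circ> \<tau>)}"

text \<open>
  A map that centralises a transitive tuple is determined by its value at one point, and that value
  is arbitrary by \<open>reach_realised_by_commuting\<close>.
\<close>

lemma card_centraliser:
  assumes \<tau>s: "\<tau>s \<in> transitive_tuples p X" and x0: "x0 \<in> X"
  shows "card (centraliser X \<tau>s) = card X"
proof -
  have perm: "\<tau> permutes X" if "\<tau> \<in> set \<tau>s" for \<tau>
    using \<tau>s that by (simp add: transitive_tuples_def commuting_tuples_def)
  have comm: "f \<circ> g = g \<circ> f" if "f \<in> set \<tau>s" "g \<in> set \<tau>s" for f g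
    using \<tau>s that by (simp add: transitive_tuples_def commuting_tuples_def)
  have X: "reach (set \<tau>s) x0 = X" using \<tau>s x0 by (simp add: transitive_tuples_def)
  have "bij_betw (\<lambda>c. c x0) (centraliser X \<tau>s) X"
  proof (rule bij_betwI')
    fix c d assume c: "c \<in> centraliser X \<tau>s" and d: "d \<in> centraliser X \<tau>s"
    show "(c x0 = d x0) = (c = d)"
    proof
      assume eq: "c x0 = d x0"
      have "c y = d y" if "y \<in> reach (set \<tau>s) x0" for y
        using that
      proof induction
        case (step y f)
        have "c (f y) = f (c y)" "d (f y) = f (d y)"
          using c d step(2) by (auto simp: centraliser_def fun_eq_iff)
        with step.IH show ?case by simp
      qed (rule eq)
      moreover have "c y = d y" if "y \<notin> X" for y
        using c d that permutes_not_in[of c X] permutes_not_in[of d X] by (simp add: centraliser_def)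
      ultimately show "c = d" unfolding X by blast
    qed simp
  next
    fix c assume "c \<in> centraliser X \<tau>s"
    then show "c x0 \<in> X" using x0 by (simp add: centraliser_def permutes_in_image)
  next
    fix y assume "y \<in> X"
    then have "y \<in> reach (set \<tau>s) x0" by (simp add: X)
    from reach_realised_by_commuting[OF perm comm this]
    show "\<exists>c\<in>centraliser X \<tau>s. y = c x0" by (auto simp: centraliser_def)
  qed
  then show ?thesis by (rule bij_betw_same_card)
qed

text \<open>
  Conjugation of a self-map \<open>h\<close> of \<open>I\<close> by the bijection \<open>e\<close> from \<open>I\<close>, extended by the identity.
\<close>

definition transport :: "'i set \<Rightarrow> ('i \<Rightarrow> 'a) \<Rightarrow> ('i \<Rightarrow> 'i) \<Rightarrow> 'a \<Rightarrow> 'a" where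
  "transport I e h x = (if x \<in> e ` I then e (h (inv_into I e x)) else x)"

lemma transport_apply: "inj_on e I \<Longrightarrow> u \<in> I \<Longrightarrow> transport I e h (e u) = e (h u)"
  by (simp add: transport_def)

lemma transport_permutes:
  assumes "bij_betw e I X" "bij_betw h I I"
  shows "transport I e h permutes X"
proof (rule bij_imp_permutes)
  have "bij_betw (e \<circ> h \<circ> inv_into I e) X X"
    using bij_betw_trans[OF bij_betw_inv_into[OF assms(1)] bij_betw_trans[OF assms(2,1)]]
    by (simp add: comp_assoc)
  then show "bij_betw (transport I e h) X X"
    using assms(1) by (subst bij_betw_cong[where g = "e \<circ> h \<circ> inv_into I e"])
      (auto simp: transport_def bij_betw_def)
qed (use assms in \<open>auto simp: transport_def bij_betw_def\<close>)

lemma transport_commute: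
  assumes e: "bij_betw e I X" and h: "\<And>u. u \<in> I \<Longrightarrow> h u \<in> I" and k: "\<And>u. u \<in> I \<Longrightarrow> k u \<in> I"
    and hk: "\<And>u. u \<in> I \<Longrightarrow> h (k u) = k (h u)"
  shows "transport I e h \<circ> transport I e k = transport I e k \<circ> transport I e h"
proof
  fix x
  have inj: "inj_on e I" using e by (simp add: bij_betw_def)
  show "(transport I e h \<circ> transport I e k) x = (transport I e k \<circ> transport I e h) x"
  proof (cases "x \<in> e ` I")
    case True
    then show ?thesis using h k hk by (auto simp: transport_apply[OF inj])
  qed (simp add: transport_def)
qed

text \<open>
  On the stack of \<open>m\<close> copies of \<open>B\<close>, the map that moves up one copy and applies \<open>c\<close> on the way from
  the top copy back to the bottom one; so \<open>c\<close> is its return map to the bottom copy.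
\<close>

definition rotate_layers :: "nat \<Rightarrow> ('a \<Rightarrow> 'a) \<Rightarrow> nat \<times> 'a \<Rightarrow> nat \<times> 'a" where
  "rotate_layers m c = (\<lambda>(i, b). if Suc i < m then (Suc i, b) else (0, c b))"

definition every_layer :: "('a \<Rightarrow> 'a) \<Rightarrow> nat \<times> 'a \<Rightarrow> nat \<times> 'a" where
  "every_layer \<tau> = (\<lambda>(i, b). (i, \<tau> b))"

lemma bij_rotate_layers:
  assumes "c permutes B" "finite B" "m > 0"
  shows "bij_betw (rotate_layers m c) ({..<m} \<times> B) ({..<m} \<times> B)"
proof -
  have "inj_on (rotate_layers m c) ({..<m} \<times> B)"
    using permutes_inj[OF assms(1)]
    by (auto simp: inj_on_def rotate_layers_def dest: injD split: if_splits)
  moreover have "rotate_layers m c ` ({..<m} \<times> B) \<subseteq> {..<m} \<times> B"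
    using assms by (auto simp: rotate_layers_def permutes_in_image split: if_splits)
  ultimately show ?thesis
    using assms by (simp add: bij_betw_def endo_inj_surj)
qed

lemma bij_every_layer:
  assumes "\<tau> permutes B"
  shows "bij_betw (every_layer \<tau>) ({..<m} \<times> B) ({..<m} \<times> B)"
  unfolding every_layer_def
  using bij_betw_map_prod[OF bij_betw_id permutes_imp_bij[OF assms]]
  by (simp add: map_prod_def)

text \<open>
  The bijections by which \<open>X\<close> is identified with a stack of \<open>m\<close> copies of its subset \<open>B\<close>, the bottom
  copy being \<open>B\<close> itself. Extensionality makes the set finite.
\<close>

definition layerings :: "nat \<Rightarrow> 'a set \<Rightarrow> 'a set \<Rightarrow> (nat \<times> 'a \<Rightarrow> 'a) set" where
  "layerings m B X = {e \<in> extensional ({..<m} \<times> B).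
     bij_betw e ({..<m} \<times> B) X \<and> (\<forall>b\<in>B. e (0, b) = b)}"

text \<open>
  Any two layerings differ by a permutation of \<open>X\<close> that fixes \<open>B\<close> pointwise, so the permutations of
  \<open>X - B\<close> act simply transitively on them.
\<close>

lemma card_layerings:
  assumes fin: "finite X" and B: "B \<subseteq> X" and card: "card X = m * card B" and m: "m > 0"
  shows "card (layerings m B X) = fact (card X - card B)"
proof -
  let ?I = "{..<m} \<times> B"
  have finB: "finite B" using fin B finite_subset by blast
  have I: "?I = {0} \<times> B \<union> {1..<m} \<times> B" "({0} \<times> B) \<inter> ({1..<m} \<times> B) = {}" using m by auto
  have "card ({1..<m} \<times> B) = card (X - B)"
    using card finB B by (simp add: card_Diff_subset card_cartesian_product diff_mult_distrib)
  then obtain h where h: "bij_betw h ({1..<m} \<times> B) (X - B)"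
    using finite_same_card_bij finB fin by (metis finite_Diff finite_SigmaI finite_atLeastLessThan)
  define e0 where "e0 = (\<lambda>(i, b). if i = 0 then b else h (i, b))"
  have "bij_betw e0 ({0} \<times> B) B" by (auto simp: e0_def bij_betw_def inj_on_def image_iff)
  moreover have "bij_betw e0 ({1..<m} \<times> B) (X - B)"
    using h by (subst bij_betw_cong[where g = h]) (auto simp: e0_def)
  ultimately have e0: "bij_betw e0 ?I X"
    using bij_betw_combine[of e0 "{0} \<times> B" B "{1..<m} \<times> B" "X - B"] B unfolding I(1)
    by (simp add: Un_absorb1)
  have e00: "e0 (0, b) = b" for b by (simp add: e0_def)
  have inj0: "inj_on e0 ?I" and img0: "e0 ` ?I = X" using e0 by (auto simp: bij_betw_def)
  have "bij_betw (\<lambda>\<pi>. restrict (\<pi> \<circ> e0) ?I) {\<pi>. \<pi> permutes (X - B)} (layerings m B X)"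
  proof (rule bij_betwI')
    fix \<pi> \<rho> assume p: "\<pi> \<in> {\<pi>. \<pi> permutes (X - B)}" "\<rho> \<in> {\<pi>. \<pi> permutes (X - B)}"
    show "(restrict (\<pi> \<circ> e0) ?I = restrict (\<rho> \<circ> e0) ?I) = (\<pi> = \<rho>)"
    proof
      assume eq: "restrict (\<pi> \<circ> e0) ?I = restrict (\<rho> \<circ> e0) ?I"
      have "\<pi> x = \<rho> x" for x
      proof (cases "x \<in> X")
        case True
        then obtain u where u: "u \<in> ?I" "x = e0 u" using img0 by blast
        have "restrict (\<pi> \<circ> e0) ?I u = restrict (\<rho> \<circ> e0) ?I u" using eq by simp
        then show ?thesis using u by simp
      next
        case False
        then show ?thesis using p by (simp add: permutes_not_in)
      qed
      then show "\<pi> = \<rho>" by blast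
    qed simp
  next
    fix \<pi> assume p: "\<pi> \<in> {\<pi>. \<pi> permutes (X - B)}"
    then have "\<pi> permutes X" using permutes_subset[of \<pi> "X - B" X] by simp
    then have "bij_betw (\<pi> \<circ> e0) ?I X" using e0 permutes_imp_bij bij_betw_trans by blast
    then have "bij_betw (restrict (\<pi> \<circ> e0) ?I) ?I X"
      by (subst bij_betw_cong[where g = "\<pi> \<circ> e0"]) auto
    then show "restrict (\<pi> \<circ> e0) ?I \<in> layerings m B X"
      using p m by (auto simp: layerings_def e00 permutes_not_in)
  next
    fix e assume e: "e \<in> layerings m B X"
    then have bij: "bij_betw e ?I X" and e_0: "\<And>b. b \<in> B \<Longrightarrow> e (0, b) = b"
      and ext: "e \<in> extensional ?I" by (auto simp: layerings_def)
    define \<pi> where "\<pi> x = (if x \<in> X then e (inv_into ?I e0 x) else x)" for x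
    have \<pi>e0: "\<pi> (e0 u) = e u" if "u \<in> ?I" for u
      using inj0 img0 that by (auto simp: \<pi>_def)
    have "bij_betw (e \<circ> inv_into ?I e0) X X"
      using bij e0 by (intro bij_betw_trans[OF bij_betw_inv_into]) auto
    then have "bij_betw \<pi> X X"
      by (subst bij_betw_cong[where g = "e \<circ> inv_into ?I e0"]) (auto simp: \<pi>_def)
    then have "\<pi> permutes X" by (rule bij_imp_permutes) (simp add: \<pi>_def)
    moreover have "\<pi> b = b" if "b \<in> B" for b using \<pi>e0[of "(0, b)"] that m by (simp add: e00 e_0)
    ultimately have "\<pi> permutes (X - B)" by (rule permutes_superset) auto
    moreover have "e = restrict (\<pi> \<circ> e0) ?I"
      using ext \<pi>e0 by (auto simp: fun_eq_iff extensional_def restrict_def)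
    ultimately show "\<exists>\<pi>\<in>{\<pi>. \<pi> permutes (X - B)}. e = restrict (\<pi> \<circ> e0) ?I" by blast
  qed
  then have "card (layerings m B X) = card {\<pi>. \<pi> permutes (X - B)}"
    by (simp add: bij_betw_same_card)
  also have "\<dots> = fact (card X - card B)"
    using fin B finB by (simp add: card_permutations card_Diff_subset)
  finally show ?thesis .
qed

lemma funpow_commute:
  assumes "\<tau> \<circ> \<sigma> = \<sigma> \<circ> \<tau>"
  shows "\<tau> \<circ> (\<sigma> ^^ i) = (\<sigma> ^^ i) \<circ> \<tau>"
proof (induction i)
  case (Suc i)
  have "\<tau> \<circ> (\<sigma> ^^ Suc i) = (\<tau> \<circ> \<sigma>) \<circ> (\<sigma> ^^ i)" by (simp add: comp_assoc)
  also have "\<dots> = \<sigma> \<circ> (\<tau> \<circ> (\<sigma> ^^ i))" by (simp only: assms comp_assoc)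
  also have "\<dots> = (\<sigma> ^^ Suc i) \<circ> \<tau>" by (simp only: Suc.IH funpow.simps comp_assoc)
  finally show ?case .
qed simp

text \<open>
  Since \<open>\<sigma>\<close> commutes with \<open>\<tau>s\<close>, its powers permute the orbits of \<open>\<tau>s\<close>. So the images of \<open>B\<close> under the
  powers of \<open>\<sigma>\<close> are pairwise equal or disjoint, and with \<open>m\<close> the least positive exponent that brings
  \<open>B\<close> back to itself, the first \<open>m\<close> of them are disjoint. Their union is invariant under the whole
  tuple, hence all of \<open>X\<close>.
\<close>

lemma layers_of_transitive:
  assumes fin: "finite X" and \<rho>: "\<sigma> # \<tau>s \<in> transitive_tuples (Suc p) X" and x0: "x0 \<in> X"
    and B: "B = reach (set \<tau>s) x0"
  obtains m where "m > 0" "(\<sigma> ^^ m) ` B = B" "bij_betw (\<lambda>(i, b). (\<sigma> ^^ i) b) ({..<m} \<times> B) X"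
proof -
  have \<sigma>: "\<sigma> permutes X" and \<tau>s: "\<tau>s \<in> commuting_tuples p X"
    and comm: "\<And>\<tau>. \<tau> \<in> set \<tau>s \<Longrightarrow> \<tau> \<circ> \<sigma> = \<sigma> \<circ> \<tau>"
    and reachX: "reach (insert \<sigma> (set \<tau>s)) x0 = X"
    using \<rho> x0 by (auto simp: transitive_tuples_def commuting_Cons)
  have perm: "\<tau> permutes X" if "\<tau> \<in> set \<tau>s" for \<tau> using \<tau>s that by (simp add: commuting_tuples_def)
  have BX: "B \<subseteq> X" unfolding B by (rule reach_subset[OF perm x0])
  have x0B: "x0 \<in> B" unfolding B by (rule reach.refl)
  note injp = permutes_inj[OF permutes_funpow[OF \<sigma>]]
  have same: "reach (set \<tau>s) b = B" if "b \<in> B" for b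
    using reach_eq[of X "set \<tau>s" x0 b, OF fin perm x0] that unfolding B by simp
  have layer: "reach (set \<tau>s) ((\<sigma> ^^ i) b) = (\<sigma> ^^ i) ` B" if "b \<in> B" for i b
    using reach_commute[of "set \<tau>s" "\<sigma> ^^ i" b] funpow_commute[OF comm] same[OF that] by simp
  have closes_up: "(\<sigma> ^^ i) ` B = B" if "b \<in> B" "(\<sigma> ^^ i) b \<in> B" for i b
    using layer[OF that(1)] same[OF that(2)] by simp
  have "permutation \<sigma>" using \<sigma> fin by (auto simp: permutation_permutes)
  then obtain N where N: "\<sigma> ^^ N = id" "N > 0" using permutation_is_nilpotent by blast
  \<comment> \<open>The first return to \<open>B\<close>; it exists because some positive power of \<open>\<sigma>\<close> is the identity.\<close>
  define m where "m = (LEAST n. n > 0 \<and> (\<sigma> ^^ n) x0 \<in> B)"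
  have "m > 0 \<and> (\<sigma> ^^ m) x0 \<in> B"
    unfolding m_def by (rule LeastI[of _ N]) (use N x0B in simp)
  then have m: "m > 0" "(\<sigma> ^^ m) ` B = B" using closes_up x0B by auto
  have first: "i = 0" if "i < m" "b \<in> B" "(\<sigma> ^^ i) b \<in> B" for i b
  proof (rule ccontr)
    assume "i \<noteq> 0"
    moreover have "(\<sigma> ^^ i) x0 \<in> B" using closes_up[OF that(2,3)] x0B by blast
    ultimately have "m \<le> i" unfolding m_def by (intro Least_le) simp
    with \<open>i < m\<close> show False by simp
  qed
  have inj: "i = j \<and> b = b'" if "i \<le> j" "j < m" "b \<in> B" "b' \<in> B" "(\<sigma> ^^ i) b = (\<sigma> ^^ j) b'" for i j b b'
  proof -
    have "(\<sigma> ^^ i) b = (\<sigma> ^^ i) ((\<sigma> ^^ (j - i)) b')"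
      using that(1,5) funpow_add[of i "j - i" \<sigma>] by simp
    then have b: "b = (\<sigma> ^^ (j - i)) b'" by (rule injD[OF injp])
    have "(\<sigma> ^^ (j - i)) b' \<in> B" using that(3) unfolding b .
    then have "j - i = 0" using first[of "j - i" b'] that(2,4) by simp
    then show ?thesis using that(1) b by simp
  qed
  have "bij_betw (\<lambda>(i, b). (\<sigma> ^^ i) b) ({..<m} \<times> B) X"
    unfolding bij_betw_def
  proof (intro conjI subset_antisym)
    show "inj_on (\<lambda>(i, b). (\<sigma> ^^ i) b) ({..<m} \<times> B)"
    proof (rule inj_onI, clarify)
      fix i j b b' assume a: "i < m" "j < m" "b \<in> B" "b' \<in> B" "(\<sigma> ^^ i) b = (\<sigma> ^^ j) b'"
      show "i = j \<and> b = b'"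
        using inj[of i j b b'] inj[of j i b' b] a by (cases "i \<le> j") auto
    qed
    show "(\<lambda>(i, b). (\<sigma> ^^ i) b) ` ({..<m} \<times> B) \<subseteq> X"
      using BX permutes_in_funpow_image[OF \<sigma>] by auto
    have "reach (insert \<sigma> (set \<tau>s)) x0 \<subseteq> (\<lambda>(i, b). (\<sigma> ^^ i) b) ` ({..<m} \<times> B)" (is "_ \<subseteq> ?U")
    proof (rule reach_least)
      show "x0 \<in> ?U" using m x0B by (intro image_eqI[of _ _ "(0, x0)"]) auto
      fix f y assume f: "f \<in> insert \<sigma> (set \<tau>s)" and "y \<in> ?U"
      then obtain i b where ib: "i < m" "b \<in> B" "y = (\<sigma> ^^ i) b" by auto
      show "f y \<in> ?U"
      proof (cases "f = \<sigma>")
        case True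
        then have fy: "f y = (\<sigma> ^^ Suc i) b" using ib by simp
        show ?thesis
        proof (cases "Suc i < m")
          case True
          then show ?thesis using ib fy by (intro image_eqI[of _ _ "(Suc i, b)"]) auto
        next
          case False
          then have "Suc i = m" using ib by simp
          then have "f y \<in> B" using fy m ib by blast
          then show ?thesis using m by (intro image_eqI[of _ _ "(0, f y)"]) auto
        qed
      next
        case False
        then have "f \<in> set \<tau>s" using f by simp
        then have "f y = (\<sigma> ^^ i) (f b)"
          using funpow_commute[OF comm[OF \<open>f \<in> set \<tau>s\<close>], of i] ib(3) by (simp add: fun_eq_iff)
        moreover have "f b \<in> B" using \<open>f \<in> set \<tau>s\<close> ib unfolding B by (auto intro: reach.step)
        ultimately show ?thesis using ib by (intro image_eqI[of _ _ "(i, f b)"]) auto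
      qed
    qed
    then show "X \<subseteq> ?U" by (simp only: reachX)
  qed
  with m that show ?thesis by blast
qed


text \<open>
  A tuple whose tail has the orbit \<open>B\<close> at \<open>x0\<close> corresponds to a transitive tuple \<open>\<tau>s\<close> on \<open>B\<close>, a return map
  \<open>c\<close> centralising \<open>\<tau>s\<close>, and a layering \<open>e\<close>: the tail acts as \<open>\<tau>s\<close> on every layer, and the head rotates
  the layers with return map \<open>c\<close>. The layering is recovered as \<open>e (i, b) = (\<sigma> ^^ i) b\<close>.
\<close>

lemma card_base_orbit:
  assumes fin: "finite X" and x0: "x0 \<in> B" and B: "B \<subseteq> X" and card: "card X = m * card B"
  shows "card {\<rho>s \<in> transitive_tuples (Suc p) X. reach (set (tl \<rho>s)) x0 = B} =
    card (transitive_tuples p B) * card B * fact (card X - card B)"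
proof -
  let ?L = "{\<rho>s \<in> transitive_tuples (Suc p) X. reach (set (tl \<rho>s)) x0 = B}"
  let ?I = "{..<m} \<times> B"
  let ?C = "Sigma (transitive_tuples p B) (centraliser B)"
  let ?\<Psi> = "\<lambda>((\<tau>s, c), e). transport ?I e (rotate_layers m c) # map (\<lambda>\<tau>. transport ?I e (every_layer \<tau>)) \<tau>s"
  have finB: "finite B" using fin B finite_subset by blast
  have "card X > 0" using fin x0 B card_gt_0_iff by blast
  then have m: "m > 0" using card by (cases m) auto
  have x0X: "x0 \<in> X" using x0 B by blast
  have rotate: "transport ?I e (rotate_layers m c) (e (i, b)) = (if Suc i < m then e (Suc i, b) else c b)"
    if "e \<in> layerings m B X" "c \<in> centraliser B \<tau>s" "i < m" "b \<in> B" for e c \<tau>s i b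
  proof -
    have "inj_on e ?I" using that(1) by (simp add: layerings_def bij_betw_def)
    moreover have "e (0, c b) = c b"
      using that by (simp add: layerings_def centraliser_def permutes_in_image)
    ultimately show ?thesis using that by (simp add: transport_apply rotate_layers_def)
  qed
  have every: "transport ?I e (every_layer \<tau>) (e (i, b)) = e (i, \<tau> b)"
    if "e \<in> layerings m B X" "i < m" "b \<in> B" for e \<tau> i b
    using that by (simp add: transport_apply every_layer_def layerings_def bij_betw_def)
  have base: "e (0, b) = b" if "e \<in> layerings m B X" "b \<in> B" for e b
    using that by (simp add: layerings_def)
  have powers: "(transport ?I e (rotate_layers m c) ^^ i) b = e (i, b)"
    if "e \<in> layerings m B X" "c \<in> centraliser B \<tau>s" "i < m" "b \<in> B" for e c \<tau>s i b
    using that(3)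
  proof (induction i)
    case 0
    show ?case using base[OF that(1,4)] by simp
  next
    case (Suc i)
    then show ?case using rotate[OF that(1,2) _ that(4), of i] by simp
  qed
  have "bij_betw ?\<Psi> (?C \<times> layerings m B X) ?L"
    unfolding bij_betw_def
  proof (intro conjI subset_antisym)
    show "inj_on ?\<Psi> (?C \<times> layerings m B X)"
    proof (rule inj_onI)
      fix u v assume uC: "u \<in> ?C \<times> layerings m B X" and vC: "v \<in> ?C \<times> layerings m B X"
        and uv: "?\<Psi> u = ?\<Psi> v"
      obtain \<tau>s c e where u: "u = ((\<tau>s, c), e)" by (metis prod.exhaust)
      obtain \<tau>s' c' e' where v: "v = ((\<tau>s', c'), e')" by (metis prod.exhaust)
      have \<tau>s: "\<tau>s \<in> transitive_tuples p B" "\<tau>s' \<in> transitive_tuples p B"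
        and c: "c \<in> centraliser B \<tau>s" and c': "c' \<in> centraliser B \<tau>s'"
        and e: "e \<in> layerings m B X" and e': "e' \<in> layerings m B X"
        using uC vC by (auto simp: u v)
      have eqr: "transport ?I e (rotate_layers m c) = transport ?I e' (rotate_layers m c')"
        and eqm: "map (\<lambda>\<tau>. transport ?I e (every_layer \<tau>)) \<tau>s = map (\<lambda>\<tau>. transport ?I e' (every_layer \<tau>)) \<tau>s'"
        using uv by (simp_all only: u v prod.case list.inject)
      have "e u = e' u" if "u \<in> ?I" for u
        using powers[OF e c, of "fst u" "snd u"] powers[OF e' c', of "fst u" "snd u"] eqr that by auto
      moreover have "e u = e' u" if "u \<notin> ?I" for u
        using extensional_arb[OF _ that, of e] extensional_arb[OF _ that, of e'] e e'
        by (simp add: layerings_def)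
      ultimately have ee: "e = e'" by blast
      \<comment> \<open>The head of the tuple maps the top layer to the bottom one by the return map.\<close>
      have "c b = c' b" if "b \<in> B" for b
        using rotate[OF e c, of "m - 1" b] rotate[OF e' c', of "m - 1" b] that m eqr
        unfolding ee[symmetric] by simp
      moreover have "c b = c' b" if "b \<notin> B" for b
        using c c' that permutes_not_in[of c B] permutes_not_in[of c' B] by (simp add: centraliser_def)
      ultimately have cc: "c = c'" by blast
      have len: "length \<tau>s = p" "length \<tau>s' = p"
        and perm: "\<And>i. i < p \<Longrightarrow> \<tau>s ! i permutes B" "\<And>i. i < p \<Longrightarrow> \<tau>s' ! i permutes B"
        using \<tau>s by (simp_all add: transitive_tuples_def commuting_nth)
      have "(\<tau>s ! i) b = (\<tau>s' ! i) b" if "i < p" for i b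
      proof (cases "b \<in> B")
        case True
        have "transport ?I e (every_layer (\<tau>s ! i)) = transport ?I e (every_layer (\<tau>s' ! i))"
          using arg_cong[OF eqm, of "\<lambda>xs. xs ! i"] that len ee by simp
        then have "e (0, (\<tau>s ! i) b) = e (0, (\<tau>s' ! i) b)"
          using every[OF e m True] by metis
        moreover have "(\<tau>s ! i) b \<in> B" "(\<tau>s' ! i) b \<in> B"
          using perm[OF that] True by (simp_all add: permutes_in_image)
        ultimately show ?thesis using base[OF e] by simp
      next
        case False
        then show ?thesis using perm[OF that] by (simp add: permutes_not_in)
      qed
      then have "\<tau>s = \<tau>s'" using len by (intro nth_equalityI) (auto simp: fun_eq_iff)
      then show "u = v" using ee cc by (simp add: u v)
    qed
  next
    show "?\<Psi> ` (?C \<times> layerings m B X) \<subseteq> ?L"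
    proof (rule image_subsetI)
      fix u assume "u \<in> ?C \<times> layerings m B X"
      then obtain \<tau>s c e where u: "u = ((\<tau>s, c), e)" and \<tau>s: "\<tau>s \<in> transitive_tuples p B"
        and c: "c \<in> centraliser B \<tau>s" and e: "e \<in> layerings m B X" by auto
      define \<sigma>' where "\<sigma>' = transport ?I e (rotate_layers m c)"
      define \<tau>s' where "\<tau>s' = map (\<lambda>\<tau>. transport ?I e (every_layer \<tau>)) \<tau>s"
      have bij: "bij_betw e ?I X" using e by (simp add: layerings_def)
      have cB: "c permutes B" and cc: "\<And>\<tau>. \<tau> \<in> set \<tau>s \<Longrightarrow> \<tau> \<circ> c = c \<circ> \<tau>"
        using c by (auto simp: centraliser_def)
      have perm: "\<And>\<tau>. \<tau> \<in> set \<tau>s \<Longrightarrow> \<tau> permutes B" and len: "length \<tau>s = p"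
        and comm: "\<And>\<tau> \<tau>'. \<tau> \<in> set \<tau>s \<Longrightarrow> \<tau>' \<in> set \<tau>s \<Longrightarrow> \<tau> \<circ> \<tau>' = \<tau>' \<circ> \<tau>"
        and reachB: "reach (set \<tau>s) x0 = B"
        using \<tau>s x0 by (auto simp: transitive_tuples_def commuting_tuples_def)
      note br = bij_rotate_layers[OF cB finB m] and be = bij_every_layer[OF perm]
      have rI: "rotate_layers m c v \<in> ?I" if "v \<in> ?I" for v using br that by (auto simp: bij_betw_def)
      have eI: "every_layer \<tau> v \<in> ?I" if "\<tau> \<in> set \<tau>s" "v \<in> ?I" for \<tau> v
        using perm that by (auto simp: every_layer_def permutes_in_image)
      have "\<tau>s' \<in> commuting_tuples p X"
      proof -
        have "transport ?I e (every_layer \<tau>) \<circ> transport ?I e (every_layer \<tau>') =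
           transport ?I e (every_layer \<tau>') \<circ> transport ?I e (every_layer \<tau>)"
          if "\<tau> \<in> set \<tau>s" "\<tau>' \<in> set \<tau>s" for \<tau> \<tau>'
          by (rule transport_commute[OF bij])
            (use eI that comm[OF that] in \<open>auto simp: every_layer_def fun_eq_iff\<close>)
        moreover have "transport ?I e (every_layer \<tau>) permutes X" if "\<tau> \<in> set \<tau>s" for \<tau>
          using transport_permutes[OF bij be[OF that]] .
        ultimately show ?thesis using len by (auto simp: commuting_tuples_def \<tau>s'_def)
      qed
      moreover have "\<sigma>' permutes X" unfolding \<sigma>'_def by (rule transport_permutes[OF bij br])
      moreover have "transport ?I e (every_layer \<tau>) \<circ> \<sigma>' = \<sigma>' \<circ> transport ?I e (every_layer \<tau>)"
        if "\<tau> \<in> set \<tau>s" for \<tau>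
        unfolding \<sigma>'_def
        by (rule transport_commute[OF bij])
          (use eI rI that cc[OF that] in \<open>auto simp: every_layer_def rotate_layers_def fun_eq_iff\<close>)
      ultimately have \<rho>: "\<sigma>' # \<tau>s' \<in> commuting_tuples (Suc p) X" by (auto simp: commuting_Cons \<tau>s'_def)
      \<comment> \<open>On the bottom layer, which is \<open>B\<close> itself, the transported tail acts as \<open>\<tau>s\<close>.\<close>
      have reach': "reach (set \<tau>s') b = B" if "b \<in> B" for b
      proof -
        have "reach (set \<tau>s') b = reach (set \<tau>s) b"
        proof (rule reach_set_cong[where S = B])
          fix i y assume iy: "i < length \<tau>s" "y \<in> B"
          then have "(\<tau>s ! i) y \<in> B" using perm by (simp add: permutes_in_image)
          moreover have "(\<tau>s' ! i) (e (0, y)) = e (0, (\<tau>s ! i) y)"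
            using iy every[OF e m] by (simp add: \<tau>s'_def)
          ultimately show "(\<tau>s' ! i) y = (\<tau>s ! i) y" "(\<tau>s' ! i) y \<in> B"
            using base[OF e] iy by simp_all
        qed (use that in \<open>auto simp: \<tau>s'_def\<close>)
        then show ?thesis using \<tau>s that by (simp add: transitive_tuples_def)
      qed
      \<comment> \<open>The tail reaches all of the bottom layer, and the head climbs from layer to layer.\<close>
      have in_reach: "e (i, b) \<in> reach (set (\<sigma>' # \<tau>s')) x0" if "i < m" "b \<in> B" for i b
        using that(1)
      proof (induction i)
        case 0
        have "b \<in> reach (set \<tau>s') x0" using reach'[OF x0] that by simp
        then have "b \<in> reach (set (\<sigma>' # \<tau>s')) x0"
          by induction (auto intro: reach.intros)
        then show ?case using base[OF e] that by simp
      next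
        case (Suc i)
        then have "e (i, b) \<in> reach (set (\<sigma>' # \<tau>s')) x0" by simp
        then have "\<sigma>' (e (i, b)) \<in> reach (set (\<sigma>' # \<tau>s')) x0" by (rule reach.step) simp
        moreover have "\<sigma>' (e (i, b)) = e (Suc i, b)"
          unfolding \<sigma>'_def using rotate[OF e c _ \<open>b \<in> B\<close>, of i] Suc.prems by simp
        ultimately show ?case by (simp only:)
      qed
      have "X \<subseteq> reach (set (\<sigma>' # \<tau>s')) x0"
      proof
        fix x assume "x \<in> X"
        then obtain i b where "i < m" "b \<in> B" "x = e (i, b)"
          using bij_betw_imp_surj_on[OF bij] by auto
        then show "x \<in> reach (set (\<sigma>' # \<tau>s')) x0" using in_reach by simp
      qed
      then have "\<sigma>' # \<tau>s' \<in> transitive_tuples (Suc p) X"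
        by (rule transitive_tuplesI[OF fin x0X \<rho>])
      then show "?\<Psi> u \<in> ?L" using reach'[OF x0] by (simp add: u \<sigma>'_def \<tau>s'_def)
    qed
  next
    show "?L \<subseteq> ?\<Psi> ` (?C \<times> layerings m B X)"
    proof
      fix \<rho>s assume L: "\<rho>s \<in> ?L"
      then have "length \<rho>s = Suc p" by (simp add: transitive_tuples_def commuting_tuples_def)
      then obtain \<sigma> \<tau>s where \<rho>s: "\<rho>s = \<sigma> # \<tau>s" by (cases \<rho>s) auto
      with L have \<rho>: "\<sigma> # \<tau>s \<in> transitive_tuples (Suc p) X" and r0: "B = reach (set \<tau>s) x0" by auto
      have \<sigma>: "\<sigma> permutes X" and \<tau>s: "\<tau>s \<in> commuting_tuples p X"
        and comm: "\<And>\<tau>. \<tau> \<in> set \<tau>s \<Longrightarrow> \<tau> \<circ> \<sigma> = \<sigma> \<circ> \<tau>"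
        using \<rho> by (auto simp: transitive_tuples_def commuting_Cons)
      have perm: "\<tau> permutes X" if "\<tau> \<in> set \<tau>s" for \<tau> using \<tau>s that by (simp add: commuting_tuples_def)
      obtain m' where m': "m' > 0" "(\<sigma> ^^ m') ` B = B"
        "bij_betw (\<lambda>(i, b). (\<sigma> ^^ i) b) ({..<m'} \<times> B) X"
        using layers_of_transitive[OF fin \<rho> x0X r0] .
      have "m' * card B = m * card B"
        using bij_betw_same_card[OF m'(3)] card by (simp add: card_cartesian_product)
      moreover have "card B > 0" using finB x0 card_gt_0_iff by blast
      ultimately have mm: "m' = m" by simp
      define e where "e = restrict (\<lambda>(i, b). (\<sigma> ^^ i) b) ?I"
      define c where "c = perm_restrict (\<sigma> ^^ m) B"
      define \<tau>s0 where "\<tau>s0 = map (\<lambda>\<tau>. perm_restrict \<tau> B) \<tau>s"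
      have "bij_betw e ?I X"
        using m'(3) unfolding mm e_def by (subst bij_betw_restrict_eq) auto
      then have e: "e \<in> layerings m B X" using m by (auto simp: layerings_def e_def)
      have inB: "\<tau> x \<in> B" if "\<tau> \<in> set \<tau>s" "x \<in> B" for \<tau> x
        using that unfolding r0 by (auto intro: reach.step)
      have \<tau>s0: "\<tau>s0 \<in> commuting_tuples p B"
        unfolding \<tau>s0_def by (rule restrict_commuting[OF \<tau>s B fin]) (rule inB)
      have "reach (set \<tau>s0) x0 = reach (set \<tau>s) x0"
        unfolding \<tau>s0_def by (rule reach_restrict[OF x0]) (rule inB)
      then have "reach (set \<tau>s0) x0 = B" using r0 by simp
      then have t: "\<tau>s0 \<in> transitive_tuples p B"
        using transitive_tuplesI[OF finB x0 \<tau>s0] by simp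
      have cin: "(\<sigma> ^^ m) b \<in> B" if "b \<in> B" for b using m'(2) that unfolding mm by blast
      have "c permutes B"
        unfolding c_def by (rule perm_restrict_permutes[OF permutes_funpow[OF \<sigma>] B fin cin])
      moreover have "perm_restrict \<tau> B \<circ> c = c \<circ> perm_restrict \<tau> B" if "\<tau> \<in> set \<tau>s" for \<tau>
      proof
        fix x
        have "\<tau> ((\<sigma> ^^ m) x) = (\<sigma> ^^ m) (\<tau> x)"
          using funpow_commute[OF comm[OF that], of m] by (simp add: fun_eq_iff)
        then show "(perm_restrict \<tau> B \<circ> c) x = (c \<circ> perm_restrict \<tau> B) x"
          using cin inB that by (simp add: c_def perm_restrict_def)
      qed
      ultimately have c: "c \<in> centraliser B \<tau>s0" by (auto simp: centraliser_def \<tau>s0_def)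
      have eq: "f = transport ?I e h"
        if "f permutes X" and "\<And>i b. i < m \<Longrightarrow> b \<in> B \<Longrightarrow> f (e (i, b)) = transport ?I e h (e (i, b))" for f h
      proof
        fix x
        show "f x = transport ?I e h x"
        proof (cases "x \<in> X")
          case True
          then obtain i b where "i < m" "b \<in> B" "x = e (i, b)"
            using bij_betw_imp_surj_on[OF \<open>bij_betw e ?I X\<close>] by auto
          then show ?thesis by (simp only: that(2))
        next
          case False
          then show ?thesis
            using \<open>bij_betw e ?I X\<close> permutes_not_in[OF that(1)] by (simp add: transport_def bij_betw_def)
        qed
      qed
      have "\<sigma> = transport ?I e (rotate_layers m c)"
      proof (rule eq[OF \<sigma>])
        fix i b assume ib: "i < m" "b \<in> B"
        have step: "\<sigma> (e (i, b)) = (\<sigma> ^^ Suc i) b" using ib by (simp add: e_def)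
        show "\<sigma> (e (i, b)) = transport ?I e (rotate_layers m c) (e (i, b))"
        proof (cases "Suc i < m")
          case True
          then show ?thesis unfolding rotate[OF e c ib] step using ib by (simp add: e_def)
        next
          case False
          then have "Suc i = m" using ib by simp
          then show ?thesis
            unfolding rotate[OF e c ib] step using ib by (simp add: c_def perm_restrict_def)
        qed
      qed
      moreover have "\<tau> = transport ?I e (every_layer (perm_restrict \<tau> B))" if "\<tau> \<in> set \<tau>s" for \<tau>
      proof (rule eq[OF perm[OF that]])
        fix i b assume ib: "i < m" "b \<in> B"
        have "\<tau> ((\<sigma> ^^ i) b) = (\<sigma> ^^ i) (\<tau> b)"
          using funpow_commute[OF comm[OF that], of i] by (simp add: fun_eq_iff)
        then show "\<tau> (e (i, b)) = transport ?I e (every_layer (perm_restrict \<tau> B)) (e (i, b))"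
          unfolding every[OF e ib] using ib inB[OF that ib(2)] by (simp add: e_def perm_restrict_def)
      qed
      then have "\<tau>s = map (\<lambda>\<tau>. transport ?I e (every_layer \<tau>)) \<tau>s0"
        unfolding \<tau>s0_def by (auto intro!: nth_equalityI)
      ultimately have "\<rho>s = ?\<Psi> ((\<tau>s0, c), e)" by (simp add: \<rho>s)
      moreover have "((\<tau>s0, c), e) \<in> ?C \<times> layerings m B X" using t c e by simp
      ultimately show "\<rho>s \<in> ?\<Psi> ` (?C \<times> layerings m B X)" by (rule image_eqI)
    qed
  qed
  then have "card ?L = card ?C * card (layerings m B X)"
    by (simp add: bij_betw_same_card[symmetric] card_cartesian_product)
  also have "card ?C = (\<Sum>\<tau>s\<in>transitive_tuples p B. card (centraliser B \<tau>s))"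
    using finB by (intro card_SigmaI ballI)
      (auto simp: finite_transitive_tuples centraliser_def finite_permutations)
  also have "\<dots> = card (transitive_tuples p B) * card B"
    using card_centraliser[OF _ x0] by simp
  finally show ?thesis using card_layerings[OF fin B card m] by simp
qed

lemma card_transitive_Suc:
  assumes fin: "finite X" and x0: "x0 \<in> X"
  shows "card (transitive_tuples (Suc p) X) =
    (\<Sum>B | x0 \<in> B \<and> B \<subseteq> X.
      if card B dvd card X then card (transitive_tuples p B) * card B * fact (card X - card B) else 0)"
    (is "_ = (\<Sum>B\<in>?J. ?f B)")
proof -
  let ?L = "\<lambda>B. {\<rho>s \<in> transitive_tuples (Suc p) X. reach (set (tl \<rho>s)) x0 = B}"
  have sub: "reach (set (tl \<rho>s)) x0 \<in> ?J" if "\<rho>s \<in> transitive_tuples (Suc p) X" for \<rho>s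
  proof -
    have "set (tl \<rho>s) \<subseteq> set \<rho>s" by (cases \<rho>s) auto
    then have "reach (set (tl \<rho>s)) x0 \<subseteq> X"
      using that x0 by (intro reach_subset) (auto simp: transitive_tuples_def commuting_tuples_def)
    then show ?thesis by (simp add: reach.refl)
  qed
  have "card (transitive_tuples (Suc p) X) = (\<Sum>B\<in>?J. card (?L B))"
    using sub fin
    by (subst card_UN_disjoint[symmetric])
      (auto simp: finite_transitive_tuples intro!: arg_cong[where f = card] finite_subset[of ?J "Pow X"])
  also have "\<dots> = (\<Sum>B\<in>?J. ?f B)"
  proof (rule sum.cong[OF HOL.refl])
    fix B assume "B \<in> ?J"
    then have B: "x0 \<in> B" "B \<subseteq> X" by auto
    show "card (?L B) = ?f B"
    proof (cases "card B dvd card X")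
      case True
      then obtain m where "card X = m * card B" by (metis dvdE mult.commute)
      from card_base_orbit[OF fin B this] True show ?thesis by simp
    next
      case False
      have "?L B = {}"
      proof (rule equals0I)
        fix \<rho>s assume L: "\<rho>s \<in> ?L B"
        then have "length \<rho>s = Suc p" by (simp add: transitive_tuples_def commuting_tuples_def)
        then obtain \<sigma> \<tau>s where \<rho>s: "\<rho>s = \<sigma> # \<tau>s" by (cases \<rho>s) auto
        have "\<sigma> # \<tau>s \<in> transitive_tuples (Suc p) X" "B = reach (set \<tau>s) x0"
          using L unfolding \<rho>s by simp_all
        from layers_of_transitive[OF fin this(1) x0 this(2)] obtain m where
          "bij_betw (\<lambda>(i, b). (\<sigma> ^^ i) b) ({..<m} \<times> B) X" by blast
        from bij_betw_same_card[OF this] have "m * card B = card X" by (simp add: card_cartesian_product)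
        with False show False using dvd_triv_right by metis
      qed
      with False show ?thesis by (simp only: card.empty if_False)
    qed
  qed
  finally show ?thesis .
qed

section \<open>The exponential formula\<close>

text \<open>
  For \<open>n \<ge> 1\<close>, the number of subgroups of index \<open>n\<close> of \<open>\<int>\<^sup>p\<close>. In the recursion \<open>d\<close> is the index of the intersection with
  the first \<open>p\<close> coordinates, and the factor \<open>d\<close> counts the positions of the remaining generator.
\<close>

fun sublattices :: "nat \<Rightarrow> nat \<Rightarrow> nat" where
  "sublattices 0 n = (if n = 1 then 1 else 0)"
| "sublattices (Suc p) n = (\<Sum>d | d dvd n. d * sublattices p d)"

lemma sum_subsets_by_card:
  fixes g :: "nat \<Rightarrow> 'b :: comm_semiring_1"
  assumes fin: "finite X" and x0: "x0 \<in> X"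
  shows "(\<Sum>B | x0 \<in> B \<and> B \<subseteq> X. g (card B)) = 
    (\<Sum>a=1..card X. of_nat (card X - 1 choose (a - 1)) * g a)"
proof -
  let ?J = "{B. x0 \<in> B \<and> B \<subseteq> X}"
  have finJ: "finite ?J" by (rule finite_subset[of _ "Pow X"]) (use fin in auto)
  have "card ` ?J \<subseteq> {1..card X}"
  proof (rule image_subsetI)
    fix B assume "B \<in> ?J"
    then have "B \<subseteq> X" "B \<noteq> {}" by auto
    then show "card B \<in> {1..card X}"
      using fin card_mono[of X B] finite_subset[of B X] card_gt_0_iff[of B] by simp
  qed
  then have "(\<Sum>B\<in>?J. g (card B)) = (\<Sum>a=1..card X. \<Sum>B | B \<in> ?J \<and> card B = a. g (card B))"
    by (intro sum.group[symmetric] finJ) auto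
  also have "\<dots> = (\<Sum>a=1..card X. of_nat (card X - 1 choose (a - 1)) * g a)"
  proof (rule sum.cong[OF HOL.refl])
    fix a assume a: "a \<in> {1..card X}"
    have "bij_betw (insert x0) {C. C \<subseteq> X - {x0} \<and> card C = a - 1} {B. B \<in> ?J \<and> card B = a}"
    proof (rule bij_betw_byWitness[where f' = "\<lambda>B. B - {x0}"])
      show "insert x0 ` {C. C \<subseteq> X - {x0} \<and> card C = a - 1} \<subseteq> {B. B \<in> ?J \<and> card B = a}"
      proof (rule image_subsetI)
        fix C assume "C \<in> {C. C \<subseteq> X - {x0} \<and> card C = a - 1}"
        moreover from this have "finite C" "x0 \<notin> C" using fin by (auto intro: finite_subset)
        ultimately show "insert x0 C \<in> {B. B \<in> ?J \<and> card B = a}" using a x0 by auto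
      qed
      show "(\<lambda>B. B - {x0}) ` {B. B \<in> ?J \<and> card B = a} \<subseteq> {C. C \<subseteq> X - {x0} \<and> card C = a - 1}"
        by (rule image_subsetI) (auto simp: card_Diff_singleton)
    qed blast+
    then have "card {B. B \<in> ?J \<and> card B = a} = card {C. C \<subseteq> X - {x0} \<and> card C = a - 1}"
      by (rule bij_betw_same_card[symmetric])
    also have "\<dots> = (card (X - {x0}) choose (a - 1))" using fin by (intro n_subsets) simp
    finally show "(\<Sum>B | B \<in> ?J \<and> card B = a. g (card B)) = of_nat (card X - 1 choose (a - 1)) * g a"
      using x0 fin by simp
  qed
  finally show ?thesis .
qed

lemma choose_times_facts:
  assumes "1 \<le> a" "a \<le> n"
  shows "(n - 1 choose (a - 1)) * (fact (a - 1) * fact (n - a)) = fact (n - 1)"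
proof -
  have "n - 1 - (a - 1) = n - a" using assms by simp
  then show ?thesis using binomial_fact_lemma[of "a - 1" "n - 1"] assms by (simp add: ac_simps)
qed

text \<open>
  The binomial coefficient that counts the sets \<open>B\<close> of size \<open>d\<close> containing the base point cancels
  against the factorials of \<open>card_base_orbit\<close>, leaving the recursion of \<open>sublattices\<close>.
\<close>

lemma card_transitive:
  assumes "finite X" "X \<noteq> {}"
  shows "card (transitive_tuples p X) = fact (card X - 1) * sublattices p (card X)"
  using assms
proof (induction p arbitrary: X)
  case 0
  obtain x0 where x0: "x0 \<in> X" using 0 by blast
  have r: "reach {} x = {x}" for x :: 'a
    using reach_least[of x "{x}" "{}"] reach.refl[of x "{}"] by auto
  have "card X = 1 \<longleftrightarrow> X = {x0}" using x0 0 by (auto simp: card_1_singleton_iff)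
  moreover have "transitive_tuples 0 X = (if X = {x0} then {[]} else {})"
    using x0 by (auto simp: transitive_tuples_def commuting_tuples_def r)
  ultimately show ?case by simp
next
  case (Suc p)
  obtain x0 where x0: "x0 \<in> X" using Suc by blast
  let ?n = "card X"
  let ?g = "\<lambda>a. if a dvd ?n then fact (a - 1) * sublattices p a * a * fact (?n - a) else 0"
  have n: "?n > 0" using Suc.prems by (simp add: card_gt_0_iff)
  have "card (transitive_tuples (Suc p) X) = (\<Sum>B | x0 \<in> B \<and> B \<subseteq> X. ?g (card B))"
    unfolding card_transitive_Suc[OF Suc.prems(1) x0]
    by (intro sum.cong HOL.refl if_cong) (subst Suc.IH, use Suc.prems in \<open>auto intro: finite_subset\<close>)
  also have "\<dots> = (\<Sum>a=1..?n. (?n - 1 choose (a - 1)) * ?g a)"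
    by (subst sum_subsets_by_card[OF Suc.prems(1) x0]) simp
  also have "\<dots> = (\<Sum>a=1..?n. if a dvd ?n then fact (?n - 1) * (a * sublattices p a) else 0)"
  proof (intro sum.cong HOL.refl)
    fix a assume "a \<in> {1..?n}"
    then have "fact (?n - 1) = (?n - 1 choose (a - 1)) * (fact (a - 1) * fact (?n - a))"
      using choose_times_facts[of a ?n] by simp
    then show "(?n - 1 choose (a - 1)) * ?g a =
        (if a dvd ?n then fact (?n - 1) * (a * sublattices p a) else 0)"
      by (simp add: ac_simps)
  qed
  also have "\<dots> = (\<Sum>a | a dvd ?n. fact (?n - 1) * (a * sublattices p a))"
    using n by (subst sum.inter_filter[symmetric])
      (auto intro!: sum.cong dest: dvd_imp_le simp: Suc_le_eq dvd_pos_nat)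
  finally show ?case by (simp add: sum_distrib_left)
qed

text \<open>
  The exponential generating function of the transitive tuples, since \<open>(a - 1)! / a! = 1 / a\<close>. The
  constant term is \<open>0\<close>, as division by zero yields zero.
\<close>

definition connected_gf :: "nat \<Rightarrow> real fps" where
  "connected_gf p = Abs_fps (\<lambda>a. sublattices p a / a)"

text \<open>
  The coefficients of \<open>x (t\<^sup>k\<^sup>+\<^sup>1)' = (k + 1) (x t') t\<^sup>k\<close>: the operator \<open>x d/dx\<close> marks a point, which is the
  base point whose orbit gets split off.
\<close>

lemma connected_gf_power_Suc_nth:
  "real n * (connected_gf p ^ Suc k) $ n =
     Suc k * (\<Sum>a=1..n. sublattices p a * (connected_gf p ^ k) $ (n - a))"
proof -
  let ?t = "connected_gf p"
  have "(fps_X * fps_deriv ?t) $ a = (if a = 0 then 0 else real (sublattices p a))" for a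
    by (cases a) (simp_all add: connected_gf_def)
  then have "(fps_X * fps_deriv ?t * ?t ^ k) $ n =
      (\<Sum>a=0..n. (if a = 0 then 0 else real (sublattices p a)) * (?t ^ k) $ (n - a))"
    by (simp only: fps_mult_nth[of "fps_X * fps_deriv ?t"])
  also have "\<dots> = (\<Sum>a=1..n. sublattices p a * (?t ^ k) $ (n - a))"
    by (rule sum.mono_neutral_cong_right) auto
  finally have "(fps_X * fps_deriv ?t * ?t ^ k) $ n = (\<Sum>a=1..n. sublattices p a * (?t ^ k) $ (n - a))" .
  moreover have "real n * (?t ^ Suc k) $ n = (fps_X * fps_deriv (?t ^ Suc k)) $ n"
    by (cases n) (simp_all del: power_Suc)
  moreover have "fps_X * fps_deriv (?t ^ Suc k) = fps_const (real (Suc k)) * (fps_X * fps_deriv ?t * ?t ^ k)"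
    by (simp add: fps_deriv_power ac_simps del: power_Suc)
  ultimately show ?thesis by (simp del: power_Suc)
qed

lemma card_commuting_with_orbits:
  assumes "finite X"
  shows "real (card (commuting_with_orbits p X k)) =
    fact (card X) / fact k * (connected_gf p ^ k) $ card X"
  using assms
proof (induction k arbitrary: X)
  case 0
  have empty: "commuting_tuples p ({} :: 'a set) = {replicate p id}"
    by (auto simp: commuting_tuples_def intro!: replicate_eqI)
  show ?case
  proof (cases "X = {}")
    case True
    then show ?thesis by (simp add: commuting_with_orbits_def empty)
  next
    case False
    then show ?thesis using 0 by (simp add: commuting_with_orbits_def)
  qed
next
  case (Suc k)
  let ?n = "card X" and ?t = "connected_gf p"
  show ?case
  proof (cases "X = {}")
    case True
    then show ?thesis by (simp add: commuting_with_orbits_def connected_gf_def)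
  next
    case False
    then obtain x0 where x0: "x0 \<in> X" by blast
    have n: "?n > 0" using False Suc.prems by (simp add: card_gt_0_iff)
    let ?g = "\<lambda>a. fact (a - 1) * sublattices p a * (fact (?n - a) / fact k * (?t ^ k) $ (?n - a))"
    have "real (card (commuting_with_orbits p X (Suc k))) = (\<Sum>B | x0 \<in> B \<and> B \<subseteq> X. ?g (card B))"
      unfolding card_commuting_with_orbits_Suc[OF Suc.prems x0] of_nat_sum
    proof (intro sum.cong HOL.refl)
      fix B assume "B \<in> {B. x0 \<in> B \<and> B \<subseteq> X}"
      then have B: "B \<subseteq> X" "B \<noteq> {}" "finite B" using Suc.prems by (auto intro: finite_subset)
      show "real (card (transitive_tuples p B) * card (commuting_with_orbits p (X - B) k)) = ?g (card B)"
        using B Suc.IH[of "X - B"] Suc.prems by (simp add: card_transitive card_Diff_subset)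
    qed
    also have "\<dots> = (\<Sum>a=1..?n. real (?n - 1 choose (a - 1)) * ?g a)"
      by (rule sum_subsets_by_card[OF Suc.prems x0])
    also have "\<dots> = (\<Sum>a=1..?n. fact (?n - 1) / fact k * (sublattices p a * (?t ^ k) $ (?n - a)))"
    proof (intro sum.cong HOL.refl)
      fix a assume "a \<in> {1..?n}"
      then have "real (?n - 1 choose (a - 1)) * (fact (a - 1) * fact (?n - a)) = fact (?n - 1)"
        using arg_cong[OF choose_times_facts[of a ?n], of real] by simp
      then have "fact (?n - 1) / fact k * (sublattices p a * (?t ^ k) $ (?n - a)) =
        real (?n - 1 choose (a - 1)) * (fact (a - 1) * fact (?n - a)) / fact k * (sublattices p a * (?t ^ k) $ (?n - a))"
        by simp
      then show "real (?n - 1 choose (a - 1)) * ?g a =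
          fact (?n - 1) / fact k * (sublattices p a * (?t ^ k) $ (?n - a))"
        by (simp only: times_divide_eq_left times_divide_eq_right of_nat_mult of_nat_fact ac_simps)
    qed
    also have "\<dots> = fact (?n - 1) / fact k * (real ?n * (?t ^ Suc k) $ ?n / Suc k)"
      unfolding connected_gf_power_Suc_nth sum_distrib_left[symmetric]
      by (simp only: nonzero_mult_div_cancel_left of_nat_eq_0_iff nat.simps not_False_eq_True)
    also have "\<dots> = (real ?n * fact (?n - 1)) / (real (Suc k) * fact k) * (?t ^ Suc k) $ ?n"
      by (simp add: ac_simps del: power_Suc of_nat_Suc)
    also have "\<dots> = fact ?n / fact (Suc k) * (?t ^ Suc k) $ ?n"
      using n by (simp only: fact_reduce[OF n] fact_Suc)
    finally show ?thesis .
  qed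
qed

section \<open>Asymptotics of the number of sublattices\<close>

text \<open>
  The multiplicative function with value \<open>g q m\<close> at the prime power \<open>q\<^sup>m\<close>.
\<close>

definition prime_power_prod :: "(nat \<Rightarrow> nat \<Rightarrow> real) \<Rightarrow> nat \<Rightarrow> real" where
  "prime_power_prod g n = (\<Prod>q\<in>prime_factors n. g q (multiplicity q n))"

lemma prime_power_prod_superset:
  assumes "\<And>q. g q 0 = 1" "finite S" "prime_factors n \<subseteq> S" "\<And>q. q \<in> S \<Longrightarrow> prime q" "n > 0"
  shows "prime_power_prod g n = (\<Prod>q\<in>S. g q (multiplicity q n))"
  unfolding prime_power_prod_def
proof (rule prod.mono_neutral_left[OF assms(2,3)], rule ballI)
  fix q assume "q \<in> S - prime_factors n"
  then have "\<not> q dvd n" using assms by (auto simp: in_prime_factors_iff)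
  then show "g q (multiplicity q n) = 1" by (simp add: not_dvd_imp_multiplicity_0 assms(1))
qed

lemma prime_power_prod_mult:
  assumes g: "\<And>q. g q 0 = 1" and q: "prime q" and nd: "\<not> q dvd d" and d: "d > 0"
  shows "prime_power_prod g (q ^ j * d) = g q j * prime_power_prod g d"
proof -
  let ?S = "prime_factors d"
  have q0: "q > 0" using q prime_gt_0_nat by blast
  have "r = q" if "prime r" "r dvd q ^ j" for r
    using that q prime_dvd_power primes_dvd_imp_eq by blast
  then have S: "prime_factors (q ^ j * d) \<subseteq> insert q ?S"
    using d q0 by (auto simp: in_prime_factors_iff prime_dvd_mult_iff)
  have qS: "q \<notin> ?S" using nd by auto
  have pr: "prime r" if "r \<in> insert q ?S" for r using that q by auto
  have "multiplicity q (q ^ j * d) = j"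
    using q nd d by (simp add: prime_elem_multiplicity_mult_distrib not_dvd_imp_multiplicity_0)
  moreover have "multiplicity r (q ^ j * d) = multiplicity r d" if "r \<in> ?S" for r
  proof -
    have r: "prime r" "r \<noteq> q" using that qS by auto
    then have "\<not> r dvd q ^ j" using q primes_dvd_imp_eq prime_dvd_power by blast
    then show ?thesis using r by (intro multiplicity_prime_elem_times_other) auto
  qed
  ultimately have "(\<Prod>r\<in>insert q ?S. g r (multiplicity r (q ^ j * d))) =
      g q j * (\<Prod>r\<in>?S. g r (multiplicity r d))"
    using qS by simp
  then show ?thesis
    using prime_power_prod_superset[of g, OF g _ S pr] q0 d by (simp add: prime_power_prod_def)
qed

text \<open>
  If \<open>q\<^sup>m\<close> is the exact power of \<open>q\<close> in \<open>n = q\<^sup>m n'\<close>, the divisors of \<open>n\<close> are the products \<open>q\<^sup>j d\<close> with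
  \<open>j \<le> m\<close> and \<open>d\<close> dividing \<open>n'\<close>, so the sum factors and the primes can be peeled off one by one.
\<close>

lemma sum_divisors_prime_power_prod:
  assumes g: "\<And>q. g q 0 = 1" and "n > 0"
  shows "(\<Sum>d | d dvd n. real d * prime_power_prod g d) =
    prime_power_prod (\<lambda>q m. \<Sum>j\<le>m. real q ^ j * g q j) n"
  using \<open>n > 0\<close>
proof (induction n rule: less_induct)
  case (less n)
  let ?h = "\<lambda>q m. \<Sum>j\<le>m. real q ^ j * g q j"
  show ?case
  proof (cases "n = 1")
    case True
    then show ?thesis by (simp add: prime_power_prod_def)
  next
    case False
    then obtain q where q: "prime q" "q dvd n" using prime_factor_nat by blast
    have q1: "q > 1" using q(1) by (rule prime_gt_1_nat)
    define m where "m = multiplicity q n"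
    have "n \<noteq> 0" "\<not> is_unit q" using less.prems q1 by auto
    then obtain n' where n': "n = q ^ m * n'" "\<not> q dvd n'"
      unfolding m_def by (rule multiplicity_decompose')
    have n'0: "n' > 0" using n' less.prems by (cases n') auto
    have m0: "m > 0" using q n' by (cases m) auto
    have "1 < q ^ m" using q1 m0 by (rule one_less_power)
    then have n'n: "n' < n" using n' n'0 by simp
    have bij: "bij_betw (\<lambda>(j, d). q ^ j * d) ({..m} \<times> {d. d dvd n'}) {d. d dvd n}"
      unfolding bij_betw_def
    proof (intro conjI)
      have nd: "\<not> q dvd d" "d > 0" if "d dvd n'" for d
        using that n'(2) n'0 dvd_trans dvd_pos_nat by blast+
      have mult: "multiplicity q (q ^ j * d) = j" if "d dvd n'" for j d
        using q nd[OF that] by (simp add: prime_elem_multiplicity_mult_distrib not_dvd_imp_multiplicity_0)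
      show "inj_on (\<lambda>(j, d). q ^ j * d) ({..m} \<times> {d. d dvd n'})"
      proof (rule inj_onI)
        fix u v assume "u \<in> {..m} \<times> {d. d dvd n'}" "v \<in> {..m} \<times> {d. d dvd n'}"
          and "(\<lambda>(j, d). q ^ j * d) u = (\<lambda>(j, d). q ^ j * d) v"
        then obtain j d j' d' where uv: "u = (j, d)" "v = (j', d')" "d dvd n'" "d' dvd n'"
          "q ^ j * d = q ^ j' * d'" by auto
        have "j = j'" using mult[OF uv(3), of j] mult[OF uv(4), of j'] uv(5) by simp
        then show "u = v" using uv q1 by simp
      qed
      show "(\<lambda>(j, d). q ^ j * d) ` ({..m} \<times> {d. d dvd n'}) = {d. d dvd n}"
      proof (intro subset_antisym subsetI)
        fix d assume "d \<in> {d. d dvd n}"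
        then obtain u v where uv: "d = u * v" "u dvd q ^ m" "v dvd n'"
          using division_decomp[of d "q ^ m" n'] n' by auto
        then obtain j where "j \<le> m" "u = q ^ j" using divides_primepow_nat[OF q(1)] by auto
        then show "d \<in> (\<lambda>(j, d). q ^ j * d) ` ({..m} \<times> {d. d dvd n'})"
          using uv by (intro image_eqI[of _ _ "(j, v)"]) auto
      qed (auto simp: n' intro!: mult_dvd_mono le_imp_power_dvd)
    qed
    have "(\<Sum>d | d dvd n. real d * prime_power_prod g d) =
        (\<Sum>(j, d)\<in>{..m} \<times> {d. d dvd n'}. real (q ^ j * d) * prime_power_prod g (q ^ j * d))"
      using sum.reindex_bij_betw[OF bij, of "\<lambda>d. real d * prime_power_prod g d"]
      by (simp add: case_prod_unfold)
    also have "\<dots> = (\<Sum>(j, d)\<in>{..m} \<times> {d. d dvd n'}. (real q ^ j * g q j) * (real d * prime_power_prod g d))"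
    proof (rule sum.cong[OF HOL.refl], clarify)
      fix j d assume d: "d dvd n'"
      then have "\<not> q dvd d" "d > 0" using n'(2) n'0 dvd_trans dvd_pos_nat by blast+
      then show "real (q ^ j * d) * prime_power_prod g (q ^ j * d) =
          (real q ^ j * g q j) * (real d * prime_power_prod g d)"
        by (simp add: prime_power_prod_mult[of g, OF g q(1)])
    qed
    also have "\<dots> = ?h q m * (\<Sum>d | d dvd n'. real d * prime_power_prod g d)"
      by (simp add: sum_product sum.cartesian_product)
    also have "\<dots> = ?h q m * prime_power_prod ?h n'"
      by (simp only: less.IH[OF n'n n'0])
    also have "\<dots> = prime_power_prod ?h n"
      unfolding n'(1) using g by (intro prime_power_prod_mult[symmetric] q n' n'0) simp
    finally show ?thesis .
  qed
qed

text \<open>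
  The Gaussian binomial coefficient of \<open>p + m - 1\<close> over \<open>m\<close> in base \<open>q\<close>. For \<open>p = 0\<close> and \<open>m \<ge> 1\<close> the factor
  \<open>i = 1\<close> makes it \<open>0\<close>.
\<close>

definition gauss_binomial :: "nat \<Rightarrow> nat \<Rightarrow> nat \<Rightarrow> real" where
  "gauss_binomial p q m = (\<Prod>i=1..m. (real q ^ (p + i - 1) - 1) / (real q ^ i - 1))"

lemma gauss_binomial_Suc:
  "gauss_binomial p q (Suc m) =
     gauss_binomial (Suc p) q m * (real q ^ p - 1) / (real q ^ Suc m - 1)"
proof -
  have "(\<Prod>i=1..Suc m. real q ^ (p + i - 1) - 1) = (real q ^ p - 1) * (\<Prod>i=1..m. real q ^ (Suc p + i - 1) - 1)"
    by (subst prod.atLeast_Suc_atMost) (simp_all add: prod.shift_bounds_cl_Suc_ivl del: prod.cl_ivl_Suc)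
  then show ?thesis
    by (simp add: gauss_binomial_def prod_dividef)
qed

text \<open>
  The Pascal rule for Gaussian binomial coefficients, summed up.
\<close>

lemma sum_gauss_binomial:
  assumes "q \<ge> 2"
  shows "(\<Sum>j\<le>m. real q ^ j * gauss_binomial p q j) = gauss_binomial (Suc p) q m"
proof (induction m)
  case 0
  show ?case by (simp add: gauss_binomial_def)
next
  case (Suc m)
  have "real q ^ Suc m > 1" using assms by (intro one_less_power) auto
  then have nz: "real q ^ Suc m - 1 \<noteq> 0" by simp
  have "(\<Sum>j\<le>Suc m. real q ^ j * gauss_binomial p q j) =
      gauss_binomial (Suc p) q m * (1 + real q ^ Suc m * (real q ^ p - 1) / (real q ^ Suc m - 1))"
    using Suc.IH by (simp add: gauss_binomial_Suc distrib_left del: power_Suc)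
  also have "1 + real q ^ Suc m * (real q ^ p - 1) / (real q ^ Suc m - 1) =
      (real q ^ (Suc p + Suc m - 1) - 1) / (real q ^ Suc m - 1)"
    using nz by (simp add: field_simps power_add)
  also have "gauss_binomial (Suc p) q m * \<dots> = gauss_binomial (Suc p) q (Suc m)"
    by (simp add: gauss_binomial_def)
  finally show ?case .
qed

text \<open>
  Both sides satisfy the same recursion in \<open>p\<close>: the divisor sum becomes at each prime the sum
  of \<open>sum_gauss_binomial\<close>.
\<close>

lemma sublattices_closed_form:
  assumes "n > 0"
  shows "real (sublattices p n) = prime_power_prod (gauss_binomial p) n"
  using assms
proof (induction p arbitrary: n)
  case 0
  show ?case
  proof (cases "n = 1")
    case True
    then show ?thesis by (simp add: prime_power_prod_def)
  next
    case False
    then obtain q where q: "prime q" "q dvd n" using prime_factor_nat by blast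
    then have "multiplicity q n > 0" using 0 by (simp add: prime_multiplicity_gt_zero_iff)
    then have "gauss_binomial 0 q (multiplicity q n) = 0"
      unfolding gauss_binomial_def by (intro prod_zero) (auto intro!: bexI[of _ 1])
    then have "prime_power_prod (gauss_binomial 0) n = 0"
      unfolding prime_power_prod_def using q 0 by (intro prod_zero) (auto simp: in_prime_factors_iff)
    then show ?thesis using False by simp
  qed
next
  case (Suc p)
  have "real (sublattices (Suc p) n) = (\<Sum>d | d dvd n. real d * prime_power_prod (gauss_binomial p) d)"
    using Suc.IH Suc.prems by (auto intro!: sum.cong simp: dvd_pos_nat)
  also have "\<dots> = prime_power_prod (\<lambda>q m. \<Sum>j\<le>m. real q ^ j * gauss_binomial p q j) n"
    using Suc.prems by (intro sum_divisors_prime_power_prod) (auto simp: gauss_binomial_def)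
  also have "\<dots> = prime_power_prod (gauss_binomial (Suc p)) n"
    unfolding prime_power_prod_def
    by (intro prod.cong HOL.refl sum_gauss_binomial) (auto intro: prime_ge_2_nat)
  finally show ?case .
qed

text \<open>
  Each of the \<open>m\<close> numerators \<open>q\<^sup>p\<^sup>+\<^sup>i\<^sup>-\<^sup>1 - 1\<close> is asymptotically \<open>q\<^sup>p q\<^sup>i\<^sup>-\<^sup>1\<close>, and the exponents \<open>i - 1\<close> add up
  to \<open>m choose 2\<close>.
\<close>

lemma gauss_binomial_asymp:
  assumes "q \<ge> 2"
  shows "(\<lambda>p. gauss_binomial p q m / real q ^ (m * p)) \<longlonglongrightarrow>
    real q ^ (m choose 2) / (\<Prod>i=1..m. real q ^ i - 1)"
proof -
  have geometric: "(\<lambda>p. (1 / real q) ^ p) \<longlonglongrightarrow> 0" using assms by (intro LIMSEQ_power_zero) simp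
  have "(\<lambda>p. (real q ^ (i - 1) - (1 / real q) ^ p) / (real q ^ i - 1)) \<longlonglongrightarrow>
      (real q ^ (i - 1) - 0) / (real q ^ i - 1)" if "i \<in> {1..m}" for i
  proof -
    have "real q ^ i > 1" using that assms by (intro one_less_power) auto
    then show ?thesis by (intro tendsto_intros geometric) simp
  qed
  then have lim: "(\<lambda>p. \<Prod>i=1..m. (real q ^ (i - 1) - (1 / real q) ^ p) / (real q ^ i - 1)) \<longlonglongrightarrow>
     (\<Prod>i=1..m. (real q ^ (i - 1) - 0) / (real q ^ i - 1))"
    by (rule tendsto_prod)
  have "gauss_binomial p q m / real q ^ (m * p) =
      (\<Prod>i=1..m. (real q ^ (i - 1) - (1 / real q) ^ p) / (real q ^ i - 1))" for p
  proof -
    have "gauss_binomial p q m / real q ^ (m * p) =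
      gauss_binomial p q m / (\<Prod>i=1..m. real q ^ p)"
      by (simp add: power_mult[symmetric] mult.commute)
    also have "\<dots> = (\<Prod>i=1..m. (real q ^ (p + i - 1) - 1) / (real q ^ i - 1) / real q ^ p)"
      by (simp only: gauss_binomial_def prod_dividef)
    also have "\<dots> = (\<Prod>i=1..m. (real q ^ (i - 1) - (1 / real q) ^ p) / (real q ^ i - 1))"
    proof (intro prod.cong HOL.refl)
      fix i assume "i \<in> {1..m}"
      then have "real q ^ (p + i - 1) = real q ^ p * real q ^ (i - 1)"
        by (simp add: power_add[symmetric])
      then show "(real q ^ (p + i - 1) - 1) / (real q ^ i - 1) / real q ^ p =
          (real q ^ (i - 1) - (1 / real q) ^ p) / (real q ^ i - 1)"
        using assms by (simp add: field_simps power_divide)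
    qed
    finally show ?thesis .
  qed
  moreover have "(\<Prod>i=1..m. real q ^ (i - 1)) = real q ^ (m choose 2)"
    by (induction m) (simp_all add: numeral_2_eq_2 power_add mult.commute)
  ultimately show ?thesis using lim by (simp add: prod_dividef)
qed

lemma sublattices_asymp:
  assumes "a > 0"
  shows "(\<lambda>p. sublattices p a / real a / real a ^ p) \<longlonglongrightarrow> H_num a"
proof -
  let ?m = "\<lambda>q. multiplicity q a"
  have a: "real a = (\<Prod>q\<in>prime_factors a. real q ^ ?m q)"
    using arg_cong[OF prime_factorization_nat[OF assms], of real] by simp
  \<comment> \<open>\<open>a ^ p\<close> is distributed over the primes in the same way as the closed form.\<close>
  have ap: "real a ^ p = (\<Prod>q\<in>prime_factors a. real q ^ (?m q * p))" for p
    unfolding a by (simp add: prod_power_distrib power_mult)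
  have "sublattices p a / real a / real a ^ p =
      (\<Prod>q\<in>prime_factors a. gauss_binomial p q (?m q) / real q ^ (?m q * p) / real q ^ ?m q)" for p
    unfolding ap by (simp add: sublattices_closed_form[OF assms] prime_power_prod_def prod_dividef a
        prod.distrib ac_simps)
  moreover have "(\<lambda>p. \<Prod>q\<in>prime_factors a. gauss_binomial p q (?m q) / real q ^ (?m q * p) / real q ^ ?m q)
      \<longlonglongrightarrow> (\<Prod>q\<in>prime_factors a. real q ^ (?m q choose 2) / (\<Prod>i=1..?m q. real q ^ i - 1) / real q ^ ?m q)"
  proof (rule tendsto_prod)
    fix q assume "q \<in> prime_factors a"
    then have "q \<ge> 2" using prime_ge_2_nat[of q] by blast
    then show "(\<lambda>p. gauss_binomial p q (?m q) / real q ^ (?m q * p) / real q ^ ?m q)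
        \<longlonglongrightarrow> real q ^ (?m q choose 2) / (\<Prod>i=1..?m q. real q ^ i - 1) / real q ^ ?m q"
      by (intro tendsto_divide[OF gauss_binomial_asymp tendsto_const]) auto
  qed
  moreover have "(\<Prod>q\<in>prime_factors a. real q ^ (?m q choose 2) / (\<Prod>i=1..?m q. real q ^ i - 1) / real q ^ ?m q) = H_num a"
    unfolding H_num_def Let_def
  proof (intro prod.cong HOL.refl)
    fix q assume "q \<in> prime_factors a"
    then have "real q \<noteq> 0" using prime_gt_0_nat[of q] by auto
    then show "real q ^ (?m q choose 2) / (\<Prod>i=1..?m q. real q ^ i - 1) / real q ^ ?m q =
        real q powi (int (?m q choose 2) - int (?m q)) / (\<Prod>i=1..?m q. real q ^ i - 1)"
      by (simp add: power_int_diff power_int_of_nat)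
  qed
  ultimately show ?thesis by simp
qed

lemma H_num_pos: "H_num a > 0"
  unfolding H_num_def Let_def
proof (intro prod_pos divide_pos_pos)
  fix q i assume q: "q \<in> prime_factors a"
  then have q2: "real q \<ge> 2" using prime_ge_2_nat[of q] by auto
  then show "real q powi (int (multiplicity q a choose 2) - int (multiplicity q a)) > 0" by simp
  assume "i \<in> {1..multiplicity q a}"
  then have "real q ^ i > 1" using q2 by (intro one_less_power) auto
  then show "real q ^ i - 1 > 0" by simp
qed

section \<open>Compositions with maximal product\<close>

text \<open>
  The parts of the most even composition of \<open>n\<close> into \<open>k\<close> parts.
\<close>

definition balanced :: "nat \<Rightarrow> nat \<Rightarrow> nat multiset" where
  "balanced n k = replicate_mset (k - n mod k) (n div k) + replicate_mset (n mod k) (n div k + 1)"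

lemma balanced_sum: "k > 0 \<Longrightarrow> sum_mset (balanced n k) = n"
proof -
  assume k: "k > 0"
  then have "n mod k < k" by simp
  then have "(k - n mod k) * (n div k) + n mod k * (n div k + 1) = k * (n div k) + n mod k"
    by (simp add: algebra_simps add_mult_distrib[symmetric])
  then show ?thesis by (simp add: balanced_def sum_mset_replicate_mset)
qed

text \<open>
  The sum of a list with entries \<open>b\<close> and \<open>b + 1\<close> determines how often each of them occurs.
\<close>

lemma mset_two_consecutive:
  assumes "set l \<subseteq> {b, b + 1}"
  shows "\<exists>c \<le> length l. mset l = replicate_mset (length l - c) b + replicate_mset c (b + 1) \<and>
    sum_list l = b * length l + c"
  using assms
proof (induction l)
  case (Cons a l)
  then obtain c where c: "c \<le> length l" "mset l = replicate_mset (length l - c) b + replicate_mset c (b + 1)"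
    "sum_list l = b * length l + c" by auto
  from Cons.prems consider "a = b" | "a = b + 1" by auto
  then show ?case
  proof cases
    case 1
    then show ?thesis using c by (intro exI[of _ c]) (simp add: Suc_diff_le)
  next
    case 2
    then show ?thesis using c by (intro exI[of _ "Suc c"]) simp
  qed
qed simp

lemma mset_eq_balanced:
  assumes "length l = k" "k > 0" "sum_list l = n" "set l \<subseteq> {n div k, n div k + 1}"
  shows "mset l = balanced n k"
proof -
  obtain c where c: "c \<le> k" "mset l = replicate_mset (k - c) (n div k) + replicate_mset c (n div k + 1)"
    "n = n div k * k + c"
    using mset_two_consecutive[OF assms(4)] assms by auto
  have "n = n div k * k + n mod k" by simp
  with c(3) have "c = n mod k" by linarith
  then show ?thesis using c(2) by (simp add: balanced_def)
qed

lemma strict_Bernoulli: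
  fixes x :: real
  assumes "x > 0" "m \<ge> 2"
  shows "1 + m * x < (1 + x) ^ m"
proof -
  obtain j where m: "m = Suc j" and j: "j \<ge> 1" using assms by (cases m) auto
  have "1 + m * x < (1 + j * x) * (1 + x)"
    using assms j by (simp add: m algebra_simps)
  also have "\<dots> \<le> (1 + x) ^ j * (1 + x)"
    using Bernoulli_inequality[of x j] assms by (intro mult_right_mono) auto
  finally show ?thesis by (simp add: m mult.commute)
qed

text \<open>
  The exponential function of \<open>a\<close> that agrees with \<open>a\<close> at \<open>a = b\<close> and \<open>a = b + 1\<close>. For \<open>b \<ge> 1\<close> it exceeds
  \<open>a\<close> at all other integers by convexity, while its product over the parts of a composition depends only
  on the number of parts and on their sum.
\<close>

definition exp_secant :: "nat \<Rightarrow> nat \<Rightarrow> real" where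
  "exp_secant b a = real b * (1 + 1 / real b) powi (int a - int b)"

lemma exp_secant_pos: "b \<ge> 1 \<Longrightarrow> exp_secant b a > 0"
  unfolding exp_secant_def by (intro mult_pos_pos zero_less_power_int) (simp_all add: add_pos_nonneg)

lemma exp_secant_eq:
  assumes "b \<ge> 1"
  shows "exp_secant b b = real b" and "exp_secant b (b + 1) = real (b + 1)"
  using assms by (simp_all add: exp_secant_def field_simps)

text \<open>
  Bernoulli's inequality, for the base \<open>1 + 1 / b\<close> above \<open>b + 1\<close>, and for its inverse \<open>1 - 1 / (b + 1)\<close>
  below \<open>b\<close>.
\<close>

lemma less_exp_secant:
  assumes b: "b \<ge> 1" and "a \<noteq> b" "a \<noteq> b + 1"
  shows "real a < exp_secant b a"
proof (cases "a > b")
  case True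
  define m where "m = a - b"
  have m: "m \<ge> 2" "a = b + m" using True assms by (auto simp: m_def)
  have "1 + real m * (1 / real b) < (1 + 1 / real b) ^ m"
    using b m by (intro strict_Bernoulli) auto
  then have "real b * (1 + real m * (1 / real b)) < real b * (1 + 1 / real b) ^ m"
    using b by (intro mult_strict_left_mono) auto
  moreover have "real b * (1 + real m * (1 / real b)) = real a" using b m by (simp add: field_simps)
  ultimately show ?thesis using m by (simp add: exp_secant_def)
next
  case False
  define m where "m = b - a"
  have m: "m \<ge> 1" "b = a + m" using False assms by (auto simp: m_def)
  define y where "y = 1 / real (b + 1)"
  have y: "0 < y" "y \<le> 1" "y < 1 / real b" using b by (auto simp: y_def field_simps)
  have "1 - real m / real b < 1 - real m * y"
    using mult_strict_left_mono[OF y(3), of "real m"] m by simp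
  also have "\<dots> \<le> (1 - y) ^ m" using Bernoulli_inequality[of "- y" m] y by simp
  finally have "real b * (1 - real m / real b) < real b * (1 - y) ^ m"
    using b by (intro mult_strict_left_mono) auto
  moreover have "real b * (1 - real m / real b) = real a" using b m by (simp add: field_simps)
  moreover have "(1 - y) ^ m = (1 + 1 / real b) powi (int a - int b)"
  proof -
    have "1 - y = inverse (1 + 1 / real b)" using b by (simp add: y_def field_simps)
    then show ?thesis using m by (simp add: power_int_minus power_inverse)
  qed
  ultimately show ?thesis by (simp add: exp_secant_def)
qed

lemma le_exp_secant: "b \<ge> 1 \<Longrightarrow> real a \<le> exp_secant b a"
  using less_exp_secant[of b a] exp_secant_eq[of b] by (cases "a = b \<or> a = b + 1") auto

lemma prod_list_exp_secant:
  assumes "b \<ge> 1"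
  shows "prod_list (map (exp_secant b) l) =
    real b ^ length l * (1 + 1 / real b) powi (int (sum_list l) - int b * int (length l))"
proof (induction l)
  case (Cons a l)
  have nz: "1 + 1 / real b \<noteq> 0" using assms by (simp add: add_pos_nonneg order_less_imp_not_eq2)
  have "int (sum_list (a # l)) - int b * int (length (a # l)) =
      (int a - int b) + (int (sum_list l) - int b * int (length l))"
    by (simp add: algebra_simps)
  then have "(1 + 1 / real b) powi (int (sum_list (a # l)) - int b * int (length (a # l))) =
      (1 + 1 / real b) powi (int a - int b) *
      (1 + 1 / real b) powi (int (sum_list l) - int b * int (length l))"
    using nz by (simp only: power_int_add simp_thms)
  with Cons.IH show ?case by (simp only: list.map prod_list.Cons list.size exp_secant_def power_Suc ac_simps) (simp add: ac_simps)
qed simp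

lemma prod_list_le_exp_secant:
  assumes b: "b \<ge> 1"
  shows "real (prod_list l) \<le> prod_list (map (exp_secant b) l)"
    and "\<forall>a\<in>set l. a \<ge> 1 \<Longrightarrow> \<not> set l \<subseteq> {b, b + 1} \<Longrightarrow>
      real (prod_list l) < prod_list (map (exp_secant b) l)"
proof -
  have pos: "prod_list (map (exp_secant b) l) > 0" for l
    by (induction l) (simp_all add: exp_secant_pos[OF b])
  show le: "real (prod_list l) \<le> prod_list (map (exp_secant b) l)" for l
    by (induction l) (simp_all add: mult_mono le_exp_secant[OF b] less_imp_le[OF exp_secant_pos[OF b]])
  assume "\<forall>a\<in>set l. a \<ge> 1" "\<not> set l \<subseteq> {b, b + 1}"
  then show "real (prod_list l) < prod_list (map (exp_secant b) l)"
  proof (induction l)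
    case (Cons a l)
    show ?case
    proof (cases "set l \<subseteq> {b, b + 1}")
      case True
      then have "real a < exp_secant b a" using Cons.prems by (intro less_exp_secant[OF b]) auto
      then have "real a * real (prod_list l) < exp_secant b a * real (prod_list l)"
        using Cons.prems prod_list_zero_iff[of l] by (intro mult_strict_right_mono) auto
      also have "\<dots> \<le> exp_secant b a * prod_list (map (exp_secant b) l)"
        by (intro mult_left_mono le less_imp_le[OF exp_secant_pos[OF b]])
      finally show ?thesis by simp
    next
      case False
      then have "real (prod_list l) < prod_list (map (exp_secant b) l)" using Cons by simp
      then have "real a * real (prod_list l) < real a * prod_list (map (exp_secant b) l)"
        using Cons.prems by (intro mult_strict_left_mono) auto
      also have "\<dots> \<le> exp_secant b a * prod_list (map (exp_secant b) l)"
        by (intro mult_right_mono le_exp_secant[OF b] less_imp_le[OF pos])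
      finally show ?thesis by simp
    qed
  qed simp
qed

text \<open>
  With \<open>b = n div k\<close>, replacing each part by its \<open>exp_secant\<close> value does not decrease the product, and the new
  product is the same for all compositions of \<open>n\<close> into \<open>k\<close> parts. For the balanced one it is the
  original product; any other one has a part where the replacement is a strict increase.
\<close>

lemma prod_list_le_balanced:
  assumes k: "1 \<le> k" "k \<le> n" and l: "length l = k" "sum_list l = n"
  shows "prod_list l \<le> prod_mset (balanced n k)"
    and "\<forall>a\<in>set l. a \<ge> 1 \<Longrightarrow> mset l \<noteq> balanced n k \<Longrightarrow> prod_list l < prod_mset (balanced n k)"
proof -
  let ?b = "n div k"
  have b: "?b \<ge> 1" using k by (simp add: div_greater_zero_iff Suc_le_eq)
  obtain l0 where l0: "mset l0 = balanced n k" using ex_mset by blast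
  have "size (balanced n k) = k" using k by (simp add: balanced_def)
  then have len0: "length l0 = k" using l0 by (metis size_mset)
  have sum0: "sum_list l0 = n" using l0 k by (simp add: sum_mset_sum_list[symmetric] balanced_sum)
  have "set l0 \<subseteq> {?b, ?b + 1}"
    using arg_cong[OF l0, of set_mset] by (auto simp: balanced_def split: if_splits)
  then have "map (exp_secant ?b) l0 = map real l0"
    using exp_secant_eq[OF b] by (intro map_cong) auto
  moreover have "prod_list (map real l) = real (prod_list l)" for l
    by (induction l) simp_all
  ultimately have "prod_list (map (exp_secant ?b) l0) = real (prod_list l0)" by (simp only:)
  moreover have "prod_list (map (exp_secant ?b) l0) = prod_list (map (exp_secant ?b) l)"
    unfolding prod_list_exp_secant[OF b] by (simp add: len0 sum0 l)
  moreover have "prod_list l0 = prod_mset (balanced n k)"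
    using l0 by (metis prod_mset_prod_list)
  ultimately have eq: "prod_list (map (exp_secant ?b) l) = real (prod_mset (balanced n k))" by simp
  show "prod_list l \<le> prod_mset (balanced n k)"
    using prod_list_le_exp_secant(1)[OF b, of l] unfolding eq by simp
  assume pos: "\<forall>a\<in>set l. a \<ge> 1" and "mset l \<noteq> balanced n k"
  moreover have "mset l = balanced n k" if "set l \<subseteq> {?b, ?b + 1}"
    using mset_eq_balanced l k that by simp
  ultimately show "prod_list l < prod_mset (balanced n k)"
    using prod_list_le_exp_secant(2)[OF b pos] unfolding eq by auto
qed

lemma E_num_eq:
  assumes k: "1 \<le> k" "k \<le> n"
  shows "E_num n k = prod_mset (balanced n k)"
proof -
  let ?S = "{as :: nat list. length as = k \<and> (\<forall>a\<in>set as. a \<ge> 1) \<and> sum_list as = n}"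
  have "?S \<subseteq> natpermute n k" by (auto simp: natpermute_def)
  then have fin: "finite (prod_list ` ?S)" using natpermute_finite finite_subset by blast
  obtain l0 where l0: "mset l0 = balanced n k" using ex_mset by blast
  have b: "n div k \<ge> 1" using k by (simp add: div_greater_zero_iff Suc_le_eq)
  have "size (balanced n k) = k" using k by (simp add: balanced_def)
  then have "length l0 = k" using l0 by (metis size_mset)
  moreover have "sum_list l0 = n" using l0 k by (simp add: sum_mset_sum_list[symmetric] balanced_sum)
  moreover have "\<forall>a\<in>set l0. a \<ge> 1"
    using arg_cong[OF l0, of set_mset] b by (auto simp: balanced_def split: if_splits)
  moreover have "prod_list l0 = prod_mset (balanced n k)"
    using l0 by (metis prod_mset_prod_list)
  ultimately have "prod_mset (balanced n k) \<in> prod_list ` ?S" by force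
  moreover have "x \<le> prod_mset (balanced n k)" if "x \<in> prod_list ` ?S" for x
    using that prod_list_le_balanced(1)[OF k] by auto
  moreover have "E_num n k = Max (prod_list ` ?S)"
    unfolding E_num_def by (rule arg_cong[where f = Max]) blast
  ultimately show ?thesis using Max_eqI[OF fin] by presburger
qed

lemma card_balanced_arrangements:
  assumes "k > 0"
  shows "real (card (permutations_of_multiset (balanced n k))) =
    fact k / (fact (n mod k) * fact (k - n mod k))"
proof -
  let ?M = "balanced n k" and ?b = "n div k" and ?r = "n mod k"
  have "(\<Prod>x\<in>set_mset ?M. fact (count ?M x)) = (\<Prod>x\<in>{?b, ?b + 1}. fact (count ?M x) :: nat)"
    by (rule prod.mono_neutral_left) (auto simp: balanced_def not_in_iff split: if_splits)
  also have "\<dots> = fact (k - ?r) * fact ?r" by (simp add: balanced_def)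
  finally have "card (permutations_of_multiset ?M) * (fact (k - ?r) * fact ?r) = fact k"
    using card_permutations_of_multiset_aux[of ?M] assms by (simp add: balanced_def)
  then have "real (card (permutations_of_multiset ?M)) * (fact (k - ?r) * fact ?r) = fact k"
    by (metis of_nat_fact of_nat_mult)
  then show ?thesis by (simp add: field_simps)
qed

section \<open>The asymptotics of commuting tuples\<close>

theorem theorem1p2:
  fixes n k :: nat
  assumes "1 \<le> k" and "k \<le> n"
  shows "(\<lambda>p. real (A_num p n k)) \<sim>[at_top] (\<lambda>p. F_num n k * real (E_num n k) ^ p) \<and>
         (\<lambda>p. real (A_num p n k) / (F_num n k * real (E_num n k) ^ p)) \<longlonglongrightarrow> 1"
proof -
  note k = assms
  let ?b = "n div k" and ?r = "n mod k" and ?M = "balanced n k" and ?E = "E_num n k"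
  have b: "?b \<ge> 1" using k by (simp add: div_greater_zero_iff Suc_le_eq)
  have E: "?E = prod_mset ?M" by (rule E_num_eq[OF k])
  have "0 \<notin># ?M" using b by (auto simp: balanced_def split: if_splits)
  then have E0: "?E > 0" unfolding E by (metis prod_mset_zero_iff neq0_conv)
  define W where "W = prod_mset (image_mset H_num ?M)"
  have W: "W = H_num ?b ^ (k - ?r) * H_num (?b + 1) ^ ?r"
    by (simp add: W_def balanced_def)
  \<comment> \<open>The normalised weight of a part, which tends to \<open>H_num a\<close>; the growth \<open>a ^ p\<close> is split off.\<close>
  define u where "u p a = sublattices p a / real a / real a ^ p" for p a
  have term_limit: "(\<lambda>p. prod_list (map (\<lambda>a. connected_gf p $ a) v) / real ?E ^ p) \<longlonglongrightarrow>
      (if mset v = ?M then W else 0)" if v: "v \<in> natpermute n k" for v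
  proof (cases "\<forall>a\<in>set v. a \<ge> 1")
    case False
    \<comment> \<open>A part \<open>0\<close> carries the constant term of \<open>connected_gf\<close>, which is \<open>0\<close>.\<close>
    then have "0 \<in> set v" by (auto simp: not_less_eq_eq)
    then have "prod_list (map (\<lambda>a. connected_gf p $ a) v) = 0" for p
      by (auto simp: prod_list_zero_iff connected_gf_def image_iff intro!: bexI[of _ 0])
    moreover have "mset v \<noteq> ?M" using \<open>0 \<in> set v\<close> \<open>0 \<notin># ?M\<close> by (metis set_mset_mset)
    ultimately show ?thesis by simp
  next
    case True
    have split: "prod_list (map (\<lambda>a. connected_gf p $ a) v) / real ?E ^ p =
        prod_list (map (u p) v) * (real (prod_list v) / real ?E) ^ p" for p
    proof -
      have "prod_list (map (\<lambda>a. connected_gf p $ a) v) = prod_list (map (u p) v) * real (prod_list v) ^ p"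
        using True
      proof (induction v)
        case (Cons a v)
        then have "connected_gf p $ a = u p a * real a ^ p" by (simp add: u_def connected_gf_def)
        with Cons show ?case by (simp add: power_mult_distrib)
      qed simp
      then show ?thesis by (simp add: power_divide)
    qed
    have "(\<lambda>p. prod_list (map (u p) v)) \<longlonglongrightarrow> prod_list (map H_num v)"
      using True
    proof (induction v)
      case (Cons a v)
      then have "(\<lambda>p. u p a) \<longlonglongrightarrow> H_num a" unfolding u_def by (intro sublattices_asymp) auto
      with Cons show ?case by (auto intro: tendsto_mult)
    qed simp
    moreover have "(\<lambda>p. (real (prod_list v) / real ?E) ^ p) \<longlonglongrightarrow> (if mset v = ?M then 1 else 0)"
    proof (cases "mset v = ?M")
      case True
      then have "prod_list v = ?E" unfolding E by (metis prod_mset_prod_list)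
      with True E0 show ?thesis by simp
    next
      case False
      then have "prod_list v < ?E"
        unfolding E using v True by (intro prod_list_le_balanced(2)[OF k]) (auto simp: natpermute_def)
      then have "(\<lambda>p. (real (prod_list v) / real ?E) ^ p) \<longlonglongrightarrow> 0"
        by (intro LIMSEQ_power_zero) simp
      with False show ?thesis by simp
    qed
    ultimately have "(\<lambda>p. prod_list (map (u p) v) * (real (prod_list v) / real ?E) ^ p) \<longlonglongrightarrow>
        prod_list (map H_num v) * (if mset v = ?M then 1 else 0)"
      by (rule tendsto_mult)
    moreover have "prod_list (map H_num v) = W" if "mset v = ?M"
      unfolding W_def that[symmetric] by (metis mset_map prod_mset_prod_list)
    ultimately show ?thesis unfolding split by (cases "mset v = ?M") auto
  qed
  have A: "real (A_num p n k) / real ?E ^ p = 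
      fact n / fact k * (\<Sum>v\<in>natpermute n k. prod_list (map (\<lambda>a. connected_gf p $ a) v) / real ?E ^ p)" for p
  proof -
    have "(connected_gf p ^ k) $ n = (\<Sum>v\<in>natpermute n k. \<Prod>j\<in>{0..k - 1}. connected_gf p $ (v ! j))"
      using k by (simp add: fps_power_nth)
    also have "\<dots> = (\<Sum>v\<in>natpermute n k. prod_list (map (\<lambda>a. connected_gf p $ a) v))"
    proof (intro sum.cong HOL.refl)
      fix v assume "v \<in> natpermute n k"
      then have "length v = k" by (simp add: natpermute_def)
      moreover have "{0..k - 1} = {0..<k}" using k by auto
      ultimately show "(\<Prod>j\<in>{0..k - 1}. connected_gf p $ (v ! j)) = prod_list (map (\<lambda>a. connected_gf p $ a) v)"
        by (simp add: prod.list_conv_set_nth)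
    qed
    finally show ?thesis
      by (simp add: A_num_eq card_commuting_with_orbits sum_divide_distrib[symmetric])
  qed
  have card: "{v \<in> natpermute n k. mset v = ?M} = permutations_of_multiset ?M"
  proof -
    have "v \<in> natpermute n k" if "mset v = ?M" for v
    proof -
      have "size ?M = k" "sum_mset ?M = n" using k by (simp add: balanced_def, simp add: balanced_sum)
      then show ?thesis
        using that by (metis (mono_tags) mem_Collect_eq natpermute_def size_mset sum_mset_sum_list)
    qed
    then show ?thesis by (auto simp: permutations_of_multiset_def)
  qed
  have "(\<lambda>p. real (A_num p n k) / real ?E ^ p) \<longlonglongrightarrow>
      fact n / fact k * (\<Sum>v\<in>natpermute n k. if mset v = ?M then W else 0)"
    unfolding A by (intro tendsto_mult tendsto_const tendsto_sum term_limit)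
  also have "fact n / fact k * (\<Sum>v\<in>natpermute n k. if mset v = ?M then W else 0) = F_num n k"
  proof -
    have "(\<Sum>v\<in>natpermute n k. if mset v = ?M then W else 0) = real (card (permutations_of_multiset ?M)) * W"
      unfolding card[symmetric] by (subst sum.inter_filter[symmetric]) (simp_all add: natpermute_finite)
    then show ?thesis
      using k by (simp add: card_balanced_arrangements F_num_def Let_def W)
  qed
  finally have lim: "(\<lambda>p. real (A_num p n k) / real ?E ^ p) \<longlonglongrightarrow> F_num n k" .
  have F0: "F_num n k > 0" using H_num_pos by (simp add: F_num_def Let_def)
  have "(\<lambda>p. real (A_num p n k) / real ?E ^ p / F_num n k) \<longlonglongrightarrow> F_num n k / F_num n k"
    using F0 by (intro tendsto_divide lim tendsto_const) simp
  then have ratio: "(\<lambda>p. real (A_num p n k) / (F_num n k * real ?E ^ p)) \<longlonglongrightarrow> 1"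
    using F0 by (simp add: field_simps)
  then show ?thesis using asymp_equivI'[OF ratio] by (rule conjI[rotated])
qed

end
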